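(* Let $\alpha\in(0,1)$, $\lambda_1,\lambda_2>0$, and let $\{S^{\alpha}(s,t),\ (s,t)\in\mathbb{R}^2_+\}$ be the fractional Skellam random field of type two. Its distribution $p^\alpha(n,s,t)=\mathrm{Pr}\{S^\alpha(s,t)=n\}$ is given by $$p^{\alpha}(n,s,t)=\bigg(\frac{\lambda_1}{\lambda_2}\bigg)^{n/2}\sum_{k=0}^{\infty}\frac{(|n|+2k)!\,(\sqrt{\lambda_1\lambda_2}\,s^\alpha t)^{|n|+2k}}{(|n|+k)!\,k!}E_{\alpha,\alpha(|n|+2k)+1}^{|n|+2k+1}\big(-(\lambda_1+\lambda_2)s^\alpha t\big),\quad n\in\mathbb{Z}.$$ Moreover, it solves the system of fractional differential equations $$\frac{\partial^\alpha}{\partial s^\alpha}p^{\alpha}(n,s,t)=-(\lambda_1+\lambda_2)t\,p^{\alpha}(n,s,t)+\lambda_1t\,p^{\alpha}(n-1,s,t)+\lambda_2t\,p^{\alpha}(n+1,s,t),\quad n\in\mathbb{Z},$$ with initial condition $p^{\alpha}(0,0,t)=1$ for all $t\ge0$.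
   Context: A Poisson random field on $\mathbb{R}^2_+$ with parameter $\lambda>0$ is a non-negative integer-valued random measure $\{N(B)\}$ indexed by Borel sets $B\subseteq\mathbb{R}^2_+$ such that $N(B)$ is Poisson with mean $\lambda|B|$ whenever the Lebesgue measure $|B|$ is finite, and $N(B_1),\dots,N(B_n)$ are independent for disjoint $B_1,\dots,B_n$. One writes $N(s,t)=N([0,s]\times[0,t])$. The Skellam random field is $S(s,t)=N_1(s,t)-N_2(s,t)$, where $N_1,N_2$ are independent Poisson random fields on $\mathbb{R}^2_+$ with parameters $\lambda_1,\lambda_2$. For $0<\alpha<1$, an $\alpha$-stable subordinator $\{H^\alpha(t),\ t\ge0\}$ is the non-decreasing Lévy process with $\mathbb{E}e^{-wH^\alpha(t)}=e^{-tw^\alpha}$, $w>0$; the inverse $\alpha$-stable subordinator is $E^\alpha(t)=\inf\{\tau>0:H^\alpha(\tau)>t\}$, $t\ge0$. The fractional Skellam random field of type two is $S^{\alpha}(s,t)=S(E^{\alpha}(s),t)$, where the inverse $\alpha$-stable subordinator $E^\alpha$ is independent of $S$. The three-parameter Mittag-Leffler function is $E_{a,b}^{\gamma}(x)=\sum_{r=0}^{\infty}\frac{(\gamma)_r x^r}{\Gamma(ar+b)\,r!}$, $x\in\mathbb{R}$, with $(\gamma)_r=\gamma(\gamma+1)\cdots(\gamma+r-1)$, $(\gamma)_0=1$. $\frac{\partial^\alpha}{\partial s^\alpha}$ is the Caputo derivative in $s$: $\frac{\mathrm{d}^\alpha}{\mathrm{d}x^\alpha}f(x)=\frac{1}{\Gamma(1-\alpha)}\int_0^x\frac{f'(y)}{(x-y)^\alpha}\,\mathrm{d}y$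 for $0<\alpha<1$. *)

theory Defs
  imports "HOL-Probability.Probability"
begin

definition quadrant :: "(real \<times> real) set" where
  "quadrant = {0..} \<times> {0..}"

abbreviation borel_quadrant :: "(real \<times> real) measure" where
  "borel_quadrant \<equiv> restrict_space borel quadrant"

context prob_space
begin

text \<open>
  A random measure is a family of measures \<open>N \<omega>\<close> such that every \<open>N(B)\<close> is measurable in \<open>\<omega>\<close>.
  As usual it is finite on bounded sets, so that differences of the counts \<open>N(s,t)\<close> make sense;
  on unbounded sets the value \<open>\<infinity>\<close> occurs. The Poisson law is written out rather than taken from
  \<open>poisson_pmf\<close> because Lebesgue null sets have mean \<open>0\<close>.
\<close>

definition poisson_random_field :: "real \<Rightarrow> ('a \<Rightarrow> (real \<times> real) measure) \<Rightarrow> bool" where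
  "poisson_random_field l N \<longleftrightarrow>
     (\<forall>\<omega>\<in>space M. sets (N \<omega>) = sets borel_quadrant) \<and>
     (\<forall>\<omega>\<in>space M. \<forall>B\<in>sets borel_quadrant. emeasure (N \<omega>) B \<in> range ennreal_of_enat) \<and>
     (\<forall>\<omega>\<in>space M. \<forall>B\<in>sets borel_quadrant. bounded B \<longrightarrow> emeasure (N \<omega>) B < \<infinity>) \<and>
     (\<forall>B\<in>sets borel_quadrant. random_variable borel (\<lambda>\<omega>. emeasure (N \<omega>) B)) \<and>
     (\<forall>B\<in>sets borel_quadrant. emeasure lborel B < \<infinity> \<longrightarrow>
        (\<forall>k::nat. prob {\<omega> \<in> space M. emeasure (N \<omega>) B = of_nat k} =
           (l * measure lborel B) ^ k / fact k * exp (- (l * measure lborel B)))) \<and>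
     (\<forall>(n::nat) B. (\<forall>i<n. B i \<in> sets borel_quadrant) \<and> disjoint_family_on B {..<n} \<longrightarrow>
        indep_vars (\<lambda>_. borel) (\<lambda>i \<omega>. emeasure (N \<omega>) (B i)) {..<n})"

text \<open>
  Independence of two stochastic processes (random fields, random measures) is independence of the
  \<open>\<sigma>\<close>-algebras generated by all their values. The library's \<open>indep_var\<close> on product spaces is
  not available here, since it forces both index types and both value types to agree.
\<close>

definition generated_sigma :: "'i set \<Rightarrow> ('i \<Rightarrow> 'a \<Rightarrow> 'b::topological_space) \<Rightarrow> 'a set set" where
  "generated_sigma I X =
     sigma_sets (space M) (\<Union>i\<in>I. {X i -` A \<inter> space M | A. A \<in> sets borel})"

definition indep_families ::
  "'i set \<Rightarrow> ('i \<Rightarrow> 'a \<Rightarrow> 'b::topological_space) \<Rightarrow> 'j set \<Rightarrow> ('j \<Rightarrow> 'a \<Rightarrow> 'c::topological_space) \<Rightarrow> bool"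
  where "indep_families I X J Y \<longleftrightarrow> indep_set (generated_sigma I X) (generated_sigma J Y)"

definition indep_random_measures ::
  "('a \<Rightarrow> (real \<times> real) measure) \<Rightarrow> ('a \<Rightarrow> (real \<times> real) measure) \<Rightarrow> bool" where
  "indep_random_measures N1 N2 \<longleftrightarrow>
     indep_families (sets borel_quadrant) (\<lambda>B \<omega>. emeasure (N1 \<omega>) B)
                    (sets borel_quadrant) (\<lambda>B \<omega>. emeasure (N2 \<omega>) B)"

definition indep_field_process ::
  "(real \<Rightarrow> real \<Rightarrow> 'a \<Rightarrow> real) \<Rightarrow> (real \<Rightarrow> 'a \<Rightarrow> real) \<Rightarrow> bool" where
  "indep_field_process S L \<longleftrightarrow>
     indep_families quadrant (\<lambda>(s, t). S s t) {0..} L"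

text \<open>Processes are indexed by \<open>real\<close>, but only the times \<open>t \<ge> 0\<close> matter.\<close>

definition levy_process :: "(real \<Rightarrow> 'a \<Rightarrow> real) \<Rightarrow> bool" where
  "levy_process X \<longleftrightarrow>
     (\<forall>t\<ge>0. random_variable borel (X t)) \<and>
     (AE \<omega> in M. X 0 \<omega> = 0) \<and>
     (\<forall>(n::nat) t. 0 \<le> t 0 \<and> (\<forall>i<n. t i < t (Suc i)) \<longrightarrow>
        indep_vars (\<lambda>_. borel) (\<lambda>i \<omega>. X (t (Suc i)) \<omega> - X (t i) \<omega>) {..<n}) \<and>
     (\<forall>s\<ge>0. \<forall>t\<ge>0. distr M borel (\<lambda>\<omega>. X (s + t) \<omega> - X s \<omega>) = distr M borel (X t)) \<and>
     (\<forall>\<omega>\<in>space M.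
        (\<forall>t\<ge>0. continuous (at_right t) (\<lambda>u. X u \<omega>)) \<and>
        (\<forall>t>0. \<exists>x. ((\<lambda>u. X u \<omega>) \<longlongrightarrow> x) (at_left t)))"

definition stable_subordinator :: "real \<Rightarrow> (real \<Rightarrow> 'a \<Rightarrow> real) \<Rightarrow> bool" where
  "stable_subordinator \<alpha> H \<longleftrightarrow>
     levy_process H \<and>
     (\<forall>\<omega>\<in>space M. mono_on {0..} (\<lambda>t. H t \<omega>)) \<and>
     (\<forall>t\<ge>0. \<forall>w>0. expectation (\<lambda>\<omega>. exp (- w * H t \<omega>)) = exp (- t * w powr \<alpha>))"

end

definition rect_count :: "('a \<Rightarrow> (real \<times> real) measure) \<Rightarrow> real \<Rightarrow> real \<Rightarrow> 'a \<Rightarrow> real" where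
  "rect_count N s t \<omega> = measure (N \<omega>) ({0..s} \<times> {0..t})"

definition skellam_field ::
  "('a \<Rightarrow> (real \<times> real) measure) \<Rightarrow> ('a \<Rightarrow> (real \<times> real) measure) \<Rightarrow> real \<Rightarrow> real \<Rightarrow> 'a \<Rightarrow> real"
  where "skellam_field N1 N2 s t \<omega> = rect_count N1 s t \<omega> - rect_count N2 s t \<omega>"

definition inverse_process :: "(real \<Rightarrow> 'a \<Rightarrow> real) \<Rightarrow> real \<Rightarrow> 'a \<Rightarrow> real" where
  "inverse_process H t \<omega> = Inf {\<tau>. \<tau> > 0 \<and> H \<tau> \<omega> > t}"

definition frac_skellam_field2 ::
  "('a \<Rightarrow> (real \<times> real) measure) \<Rightarrow> ('a \<Rightarrow> (real \<times> real) measure) \<Rightarrow> (real \<Rightarrow> 'a \<Rightarrow> real)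
    \<Rightarrow> real \<Rightarrow> real \<Rightarrow> 'a \<Rightarrow> real" where
  "frac_skellam_field2 N1 N2 H s t \<omega> = skellam_field N1 N2 (inverse_process H s \<omega>) t \<omega>"

definition mittag_leffler3 :: "real \<Rightarrow> real \<Rightarrow> real \<Rightarrow> real \<Rightarrow> real" where
  "mittag_leffler3 a b c x = (\<Sum>r. pochhammer c r * x ^ r / (Gamma (a * real r + b) * fact r))"

text \<open>The integrals are Lebesgue integrals over the open interval, since \<open>f\<close> need not be
  differentiable at \<open>0\<close>. As \<open>deriv\<close> and the integral are total, existence is a separate
  predicate.\<close>

definition caputo_differentiable :: "real \<Rightarrow> (real \<Rightarrow> real) \<Rightarrow> real \<Rightarrow> bool" where
  "caputo_differentiable \<alpha> f x \<longleftrightarrow>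
     (\<forall>y\<in>{0<..<x}. f differentiable (at y)) \<and>
     set_integrable lborel {0<..<x} (\<lambda>y. deriv f y / (x - y) powr \<alpha>)"

definition caputo_deriv :: "real \<Rightarrow> (real \<Rightarrow> real) \<Rightarrow> real \<Rightarrow> real" where
  "caputo_deriv \<alpha> f x = 1 / Gamma (1 - \<alpha>) * (LBINT y:{0<..<x}. deriv f y / (x - y) powr \<alpha>)"

end

theory Submission
  imports Defs
begin

text \<open>
  Given the value \<open>e\<close> of \<open>E\<^sup>\<alpha>(s)\<close>, the field \<open>S(e, t)\<close> is a difference of two independent Poisson
  variables with means \<open>\<lambda>\<^sub>1 e t\<close> and \<open>\<lambda>\<^sub>2 e t\<close>. Writing \<open>q\<^sub>n(x)\<close> for the probability of \<open>n\<close>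
  under the Skellam law with parameters \<open>\<lambda>\<^sub>1 x\<close> and \<open>\<lambda>\<^sub>2 x\<close> (\<open>skellam_pmf\<close>), independence gives
  \<open>p\<^sup>\<alpha>(n, s, t) = E q\<^sub>n(t E\<^sup>\<alpha>(s))\<close>. The random time \<open>E\<^sup>\<alpha>(s)\<close> is approximated from the right by
  grid points, where independence of events suffices; the counts are right-continuous and
  integer-valued, hence eventually constant along the approximation
  (\<open>prob_at_independent_time\<close>, \<open>prob_frac_skellam_field2\<close>).

  The law of \<open>E\<^sup>\<alpha>(s)\<close> is that of \<open>s\<^sup>\<alpha> Y\<close> with \<open>Y = H(1)\<^bsup>-\<alpha>\<^esup>\<close>: up to boundary cases
  \<open>E\<^sup>\<alpha>(s) < x\<close> means \<open>H(x) > s\<close>, and \<open>H(x)\<close> has the law of \<open>x\<^bsup>1/\<alpha>\<^esup> H(1)\<close> because both have the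
  same Laplace transform (\<open>distr_inverse_process\<close>). The moments of \<open>Y\<close> come from the Gamma integral
  for \<open>H(1)\<^bsup>-\<alpha>m\<^esup>\<close> and Tonelli's theorem: \<open>E Y\<^sup>m = m! / \<Gamma>(\<alpha>m + 1)\<close>
  (\<open>stable_subordinator_negative_moments\<close>). Consequently, taking expectations turns
  \<open>\<Sum> a\<^sub>m (x Y)\<^sup>m / m!\<close> into \<open>\<Sum> a\<^sub>m x\<^sup>m / \<Gamma>(\<alpha>m + 1)\<close> for every sequence \<open>a\<^sub>m\<close> of at most geometric growth
  (\<open>expectation_power_series\<close>), since the latter series converges everywhere.

  Both claims are instances of this rule. For the distribution, \<open>q\<^sub>n\<close> is a series with nonnegative terms
  in \<open>x\<^sup>N exp (-(\<lambda>\<^sub>1 + \<lambda>\<^sub>2) x)\<close>, \<open>N = |n| + 2k\<close>, and each such function has a three-parameter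
  Mittag-Leffler function as its expectation (\<open>expectation_power_exp\<close>). For the equation, the \<open>q\<^sub>n\<close> solve
  \<open>q' = G q\<close> with a bounded operator \<open>G\<close> (\<open>skellam_generator\<close>), so they have Taylor coefficients
  \<open>G\<^sup>m q(0) / m!\<close>, and \<open>p\<^sup>\<alpha>(n, s, t) = \<Sum> (G\<^sup>m q(0))\<^sub>n (s\<^sup>\<alpha> t)\<^sup>m / \<Gamma>(\<alpha>m + 1)\<close>. By the Beta
  integral the Caputo derivative sends \<open>s\<^bsup>\<alpha>m\<^esup> / \<Gamma>(\<alpha>m + 1)\<close> to the same expression with \<open>m - 1\<close> in
  place of \<open>m\<close> if \<open>m \<ge> 1\<close>, and constants to \<open>0\<close> (\<open>caputo_powr_series\<close>). On the coefficients this
  index shift is one application of \<open>t G\<close>.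
\<close>

section \<open>Entire series with Gamma function coefficients\<close>

text \<open>
  The part of the Gamma integral over \<open>[R, \<infinity>)\<close> is already this large. As \<open>R\<close> is arbitrary, the Gamma
  function outgrows every exponential.
\<close>

lemma Gamma_ge_powr:
  fixes a R :: real
  assumes "0 \<le> a" "0 < R"
  shows "R powr a * exp (- R) \<le> Gamma (a + 1)"
proof (rule has_integral_le)
  have "((\<lambda>t. R powr a * exp (- 1 * t)) has_integral R powr a * (exp (- 1 * R) / 1)) {R..}"
    by (intro has_integral_mult_right has_integral_exp_minus_to_infinity) simp
  then show "((\<lambda>t. if t \<in> {R..} then R powr a * exp (- t) else 0) has_integral
      R powr a * exp (- R)) {0..}"
    using assms by (subst has_integral_restrict) auto
  show "((\<lambda>t. t powr (a + 1 - 1) / exp t) has_integral Gamma (a + 1)) {0..}"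
    using assms by (intro Gamma_integral_real) auto
  show "(if t \<in> {R..} then R powr a * exp (- t) else 0) \<le> t powr (a + 1 - 1) / exp t"
    if "t \<in> {0..}" for t
    using assms by (auto simp: exp_minus divide_inverse intro!: mult_right_mono powr_mono2)
qed

lemma summable_power_div_Gamma:
  fixes \<alpha> K :: real
  assumes "0 < \<alpha>" "0 \<le> K"
  shows "summable (\<lambda>m. K ^ m / Gamma (\<alpha> * real m + 1))"
proof (rule summable_comparison_test')
  \<comment> \<open>With this choice \<open>R powr (\<alpha> * m) = (2 * K + 1) ^ m\<close>, and \<open>K / (2 * K + 1) \<le> 1 / 2\<close>.\<close>
  define R where "R = (2 * K + 1) powr (1 / \<alpha>)"
  show "summable (\<lambda>m. exp R * (1 / 2) ^ m)"
    by (intro summable_mult summable_geometric) auto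
  fix m :: nat
  have "R powr (\<alpha> * real m) = (2 * K + 1) ^ m"
    using assms by (simp add: R_def powr_powr powr_realpow)
  then have G: "(2 * K + 1) ^ m * exp (- R) \<le> Gamma (\<alpha> * real m + 1)"
    using Gamma_ge_powr[of "\<alpha> * real m" R] assms by (simp add: R_def)
  have pos: "0 < (2 * K + 1) ^ m * exp (- R)" using assms by simp
  have Gp: "0 < Gamma (\<alpha> * real m + 1)" using G pos by linarith
  have "K ^ m / Gamma (\<alpha> * real m + 1) \<le> K ^ m / ((2 * K + 1) ^ m * exp (- R))"
    using assms by (intro divide_left_mono[OF G] mult_pos_pos[OF Gp pos]) simp
  also have "\<dots> = exp R * (K / (2 * K + 1)) ^ m"
    by (simp add: exp_minus power_divide divide_simps)
  also have "\<dots> \<le> exp R * (1 / 2) ^ m"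
    using assms by (intro mult_left_mono power_mono) (auto simp: divide_simps)
  finally show "norm (K ^ m / Gamma (\<alpha> * real m + 1)) \<le> exp R * (1 / 2) ^ m"
    using assms Gp by (simp add: abs_mult)
qed

lemma summable_mult_power_div_Gamma:
  fixes \<alpha> C K z :: real
  assumes "0 < \<alpha>" "0 \<le> K" "\<And>m. \<bar>A m\<bar> \<le> C * K ^ m"
  shows "summable (\<lambda>m. A m / Gamma (\<alpha> * real m + 1) * z ^ m)"
proof (rule summable_comparison_test')
  show "summable (\<lambda>m. C * ((K * \<bar>z\<bar>) ^ m / Gamma (\<alpha> * real m + 1)))"
    using assms by (intro summable_mult summable_power_div_Gamma) auto
  fix m :: nat
  have "\<bar>A m\<bar> * \<bar>z\<bar> ^ m \<le> C * K ^ m * \<bar>z\<bar> ^ m"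
    using assms by (intro mult_right_mono) auto
  moreover have "Gamma (\<alpha> * real m + 1) > 0" using assms by (intro Gamma_real_pos) (simp add: add_nonneg_pos)
  ultimately show "norm (A m / Gamma (\<alpha> * real m + 1) * z ^ m) \<le> C * ((K * \<bar>z\<bar>) ^ m / Gamma (\<alpha> * real m + 1))"
    by (simp add: abs_mult power_abs power_mult_distrib divide_right_mono mult.assoc)
qed

section \<open>Caputo derivative of a power series in a fractional power\<close>

text \<open>
  Euler's Beta integral, rescaled from the unit interval by \<open>y = s t\<close>.
\<close>

lemma has_bochner_integral_Beta:
  fixes a b s :: real
  assumes "0 < a" "0 < b" "0 < s"
  shows "has_bochner_integral lborel
    (\<lambda>y. indicator {0<..<s} y * (y powr (a - 1) * (s - y) powr (b - 1)))
    (s powr (a + b - 1) * Beta a b)"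
proof -
  let ?f = "\<lambda>t. indicator {0<..<1} t * (t powr (a - 1) * (1 - t) powr (b - 1))"
  have "set_integrable lborel {0<..<1} (\<lambda>t. t powr (a - 1) * (1 - t) powr (b - 1))"
    using integrable_Beta[OF assms(1,2)] by (rule set_integrable_subset) auto
  then have I: "integrable lborel ?f"
    by (simp add: set_integrable_def)
  moreover have "integral\<^sup>L lborel ?f = Beta a b"
    using set_borel_integral_eq_integral(2)[of "{0<..<1}" "\<lambda>t. t powr (a - 1) * (1 - t) powr (b - 1)"]
      integral_unique[OF has_integral_Beta_real[OF assms(1,2)]] I
    by (simp add: set_integrable_def set_lebesgue_integral_def integral_open_interval_real)
  ultimately have B: "has_bochner_integral lborel ?f (Beta a b)"
    by (simp add: has_bochner_integral_iff)
  have "has_bochner_integral lborel (\<lambda>y. ?f (0 + (1 / s) * y)) (Beta a b /\<^sub>R \<bar>1 / s\<bar>)"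
    using B assms by (subst lborel_has_bochner_integral_real_affine_iff[symmetric]) auto
  then have "has_bochner_integral lborel
      (\<lambda>y. s powr (a + b - 2) * ?f (0 + (1 / s) * y)) (s powr (a + b - 2) * (Beta a b /\<^sub>R \<bar>1 / s\<bar>))"
    by (rule has_bochner_integral_mult_right)
  also have "s powr (a + b - 2) * (Beta a b /\<^sub>R \<bar>1 / s\<bar>) = s powr (a + b - 1) * Beta a b"
    using assms by (simp add: powr_mult_base[symmetric] field_simps) (simp add: powr_mult_base)
  also have "(\<lambda>y. s powr (a + b - 2) * ?f (0 + (1 / s) * y)) =
      (\<lambda>y. indicator {0<..<s} y * (y powr (a - 1) * (s - y) powr (b - 1)))"
  proof
    fix y
    show "s powr (a + b - 2) * ?f (0 + (1 / s) * y) =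
      indicator {0<..<s} y * (y powr (a - 1) * (s - y) powr (b - 1))"
    proof (cases "0 < y \<and> y < s")
      case True
      have "s powr (a + b - 2) = s powr (a - 1) * s powr (b - 1)"
        by (simp add: powr_add[symmetric] algebra_simps)
      moreover have "(1 - y / s) = (s - y) / s" using assms by (simp add: field_simps)
      ultimately show ?thesis using True assms by (simp add: powr_divide)
    qed (use assms in \<open>auto simp: indicator_def zero_less_divide_iff\<close>)
  qed
  finally show ?thesis .
qed

text \<open>
  Termwise, \<open>u\<^bsup>\<alpha>(m+1)\<^esup> / \<Gamma>(\<alpha>(m+1) + 1)\<close> has derivative \<open>u\<^bsup>\<alpha>(m+1) - 1\<^esup> / \<Gamma>(\<alpha>(m+1))\<close>, whose integral against
  \<open>(s - u)\<^bsup>-\<alpha>\<^esup>\<close> is \<open>\<Gamma>(1 - \<alpha>) s\<^bsup>\<alpha>m\<^esup> / \<Gamma>(\<alpha>m + 1)\<close> by the Beta integral. The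
  constant term vanishes under the derivative, so the coefficients are shifted by one. The exchange of sum and
  integral is dominated, because the integrals of the absolute values form a series of the same type.
\<close>

lemma caputo_powr_series:
  fixes \<alpha> K s :: real and A :: "nat \<Rightarrow> real"
  assumes \<alpha>: "0 < \<alpha>" "\<alpha> < 1" and K: "0 \<le> K" "\<And>m. \<bar>A m\<bar> \<le> K ^ m" and s: "0 < s"
    and f: "\<And>u. 0 < u \<Longrightarrow> f u = (\<Sum>m. A m / Gamma (\<alpha> * real m + 1) * (u powr \<alpha>) ^ m)"
  shows "caputo_differentiable \<alpha> f s"
    and "caputo_deriv \<alpha> f s = (\<Sum>m. A (Suc m) / Gamma (\<alpha> * real m + 1) * (s powr \<alpha>) ^ m)"
proof -
  \<comment> \<open>On \<open>u > 0\<close> the function \<open>f\<close> is the entire series with coefficients \<open>c\<close> evaluated at \<open>u powr \<alpha>\<close>;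
    \<open>g m\<close> is the derivative of its term of index \<open>m + 1\<close>.\<close>
  define c where "c m = A m / Gamma (\<alpha> * real m + 1)" for m
  define g where "g m u = A (Suc m) / Gamma (\<alpha> * real (Suc m)) * u powr (\<alpha> * real (Suc m) - 1)" for m u
  have sumc: "summable (\<lambda>m. c m * z ^ m)" for z
    unfolding c_def using \<alpha> K by (intro summable_mult_power_div_Gamma[where C=1 and K=K]) auto
  have Gp: "0 < Gamma (\<alpha> * real (Suc m))" for m
    using \<alpha> by (intro Gamma_real_pos) simp
  have diffs_c: "diffs c m * (u powr \<alpha>) ^ m * (\<alpha> * u powr (\<alpha> - 1)) = g m u" if "0 < u" for m u
  proof -
    have "Gamma (\<alpha> * real (Suc m) + 1) = \<alpha> * real (Suc m) * Gamma (\<alpha> * real (Suc m))"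
      using \<alpha> nonpos_Ints_nonpos[of "\<alpha> * real (Suc m)"]
      by (intro Gamma_plus1) (auto simp: mult_le_0_iff)
    then have "real (Suc m) * c (Suc m) * \<alpha> = A (Suc m) / Gamma (\<alpha> * real (Suc m))"
      using \<alpha> Gp[of m] unfolding c_def by (simp del: of_nat_Suc)
    moreover have "(u powr \<alpha>) ^ m * u powr (\<alpha> - 1) = u powr (\<alpha> * real (Suc m) - 1)"
    proof -
      have "(u powr \<alpha>) ^ m = u powr (\<alpha> * real m)"
        using that by (simp add: powr_powr flip: powr_realpow)
      then show ?thesis by (simp add: algebra_simps flip: powr_add)
    qed
    ultimately show ?thesis by (metis (no_types, lifting) diffs_def g_def mult.assoc mult.commute)
  qed
  have g_sums: "(\<lambda>m. g m u) sums (suminf (\<lambda>m. g m u))"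
    and f_deriv: "(f has_real_derivative (\<Sum>m. g m u)) (at u)" if "0 < u" for u
  proof -
    have sd: "summable (\<lambda>m. diffs c m * (u powr \<alpha>) ^ m)"
      using sumc by (rule termdiff_converges_all)
    have sg: "(\<Sum>m. diffs c m * (u powr \<alpha>) ^ m) * (\<alpha> * u powr (\<alpha> - 1)) = (\<Sum>m. g m u)"
      using suminf_mult2[OF sd, of "\<alpha> * u powr (\<alpha> - 1)"] by (simp add: diffs_c[OF that])
    show "(\<lambda>m. g m u) sums (suminf (\<lambda>m. g m u))"
      using summable_mult2[OF sd, of "\<alpha> * u powr (\<alpha> - 1)"] by (simp add: diffs_c[OF that] summable_sums)
    have "((\<lambda>u. u powr \<alpha>) has_real_derivative \<alpha> * u powr (\<alpha> - 1)) (at u)"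
      using that by (intro has_real_derivative_powr)
    from DERIV_chain2[OF termdiffs_strong_converges_everywhere[OF sumc] this]
    have "((\<lambda>u. \<Sum>m. c m * (u powr \<alpha>) ^ m) has_real_derivative (\<Sum>m. g m u)) (at u)"
      unfolding sg .
    then show "(f has_real_derivative (\<Sum>m. g m u)) (at u)"
      by (rule has_field_derivative_transform_within_open[where S="{0<..}"])
        (use that in \<open>auto simp: f c_def\<close>)
  qed
  have deriv_f: "deriv f u = (\<Sum>m. g m u)" if "0 < u" for u
    using f_deriv[OF that] by (rule DERIV_imp_deriv)
  define h where "h m y = indicator {0<..<s} y * (g m y / (s - y) powr \<alpha>)" for m y
  have h_eq: "h m y = A (Suc m) / Gamma (\<alpha> * real (Suc m)) *
      (indicator {0<..<s} y * (y powr (\<alpha> * real (Suc m) - 1) * (s - y) powr ((1 - \<alpha>) - 1)))" for m y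
    by (simp add: h_def g_def powr_minus divide_inverse)
  \<comment> \<open>The integral of \<open>h m\<close> is \<open>A (Suc m) * B m\<close>.\<close>
  define B where "B m = s powr (\<alpha> * real m) * Gamma (1 - \<alpha>) / Gamma (\<alpha> * real m + 1)" for m
  have Beta_eq: "s powr (\<alpha> * real (Suc m) + (1 - \<alpha>) - 1) * Beta (\<alpha> * real (Suc m)) (1 - \<alpha>)
      = B m * Gamma (\<alpha> * real (Suc m))" for m
    by (simp add: Beta_def B_def algebra_simps)
  have hint: "has_bochner_integral lborel (h m) (A (Suc m) * B m)" for m
  proof -
    have "has_bochner_integral lborel (h m) (A (Suc m) / Gamma (\<alpha> * real (Suc m)) *
      (s powr (\<alpha> * real (Suc m) + (1 - \<alpha>) - 1) * Beta (\<alpha> * real (Suc m)) (1 - \<alpha>)))"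
      unfolding h_eq using \<alpha> s
      by (intro has_bochner_integral_mult_right has_bochner_integral_Beta) auto
    then show ?thesis unfolding Beta_eq using Gp[of m] by (simp del: of_nat_Suc)
  qed
  have habs: "has_bochner_integral lborel (\<lambda>y. norm (h m y)) (\<bar>A (Suc m)\<bar> * B m)" for m
  proof -
    have "norm (h m y) = \<bar>A (Suc m)\<bar> / Gamma (\<alpha> * real (Suc m)) *
      (indicator {0<..<s} y * (y powr (\<alpha> * real (Suc m) - 1) * (s - y) powr ((1 - \<alpha>) - 1)))" for y
      unfolding h_eq using Gp[of m] by (simp add: abs_mult del: of_nat_Suc)
    moreover have "has_bochner_integral lborel (\<lambda>y. \<bar>A (Suc m)\<bar> / Gamma (\<alpha> * real (Suc m)) *
      (indicator {0<..<s} y * (y powr (\<alpha> * real (Suc m) - 1) * (s - y) powr ((1 - \<alpha>) - 1))))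
      (\<bar>A (Suc m)\<bar> / Gamma (\<alpha> * real (Suc m)) *
      (s powr (\<alpha> * real (Suc m) + (1 - \<alpha>) - 1) * Beta (\<alpha> * real (Suc m)) (1 - \<alpha>)))"
      using \<alpha> s
      by (intro has_bochner_integral_mult_right has_bochner_integral_Beta) auto
    ultimately show ?thesis unfolding Beta_eq using Gp[of m] by (simp del: of_nat_Suc)
  qed
  have s_pow: "s powr (\<alpha> * real m) = (s powr \<alpha>) ^ m" for m
    using s by (simp add: powr_powr flip: powr_realpow)
  have Bsum: "summable (\<lambda>m. \<bar>A (Suc m)\<bar> * B m)"
  proof (rule summable_comparison_test')
    show "summable (\<lambda>m. K * Gamma (1 - \<alpha>) * ((K * s powr \<alpha>) ^ m / Gamma (\<alpha> * real m + 1)))"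
      using \<alpha> K by (intro summable_mult summable_power_div_Gamma) auto
    fix m :: nat
    have "0 < Gamma (\<alpha> * real m + 1)" "0 < Gamma (1 - \<alpha>)"
      using \<alpha> by (auto intro!: Gamma_real_pos add_nonneg_pos)
    then show "norm (\<bar>A (Suc m)\<bar> * B m) \<le> K * Gamma (1 - \<alpha>) * ((K * s powr \<alpha>) ^ m / Gamma (\<alpha> * real m + 1))"
      using mult_right_mono[OF K(2)[of "Suc m"], of "B m"]
      by (simp add: B_def s_pow power_mult_distrib abs_mult mult_ac)
  qed
  have hsum: "summable (\<lambda>m. norm (h m y))" for y
  proof (cases "0 < y \<and> y < s")
    case True
    have "summable (\<lambda>m. \<bar>g m y\<bar>)"
    proof (rule summable_comparison_test')
      have "summable (\<lambda>m. diffs (\<lambda>m. K ^ m / Gamma (\<alpha> * real m + 1)) m * (y powr \<alpha>) ^ m)"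
        using \<alpha> K by (intro termdiff_converges_all summable_mult_power_div_Gamma[where C=1 and K=K]) auto
      then show "summable (\<lambda>m. diffs (\<lambda>m. K ^ m / Gamma (\<alpha> * real m + 1)) m * (y powr \<alpha>) ^ m * (\<alpha> * y powr (\<alpha> - 1)))"
        by (rule summable_mult2)
      fix m :: nat
      have "0 < Gamma (\<alpha> * real (Suc m) + 1)" using \<alpha> by (intro Gamma_real_pos add_nonneg_pos) auto
      then have "\<bar>diffs c m\<bar> \<le> diffs (\<lambda>m. K ^ m / Gamma (\<alpha> * real m + 1)) m"
        using K(2)[of "Suc m"] by (simp add: diffs_def c_def abs_mult divide_right_mono del: of_nat_Suc power_Suc)
      then show "norm \<bar>g m y\<bar> \<le> diffs (\<lambda>m. K ^ m / Gamma (\<alpha> * real m + 1)) m * (y powr \<alpha>) ^ m * (\<alpha> * y powr (\<alpha> - 1))"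
        using True \<alpha> by (subst diffs_c[symmetric]) (auto simp: abs_mult intro!: mult_right_mono)
    qed
    then show ?thesis
      unfolding h_def by (simp add: abs_mult summable_divide)
  next
    case False
    then have "h m y = 0" for m by (auto simp: h_def)
    then show ?thesis by simp
  qed
  have h_suminf: "indicator {0<..<s} y * (deriv f y / (s - y) powr \<alpha>) = (\<Sum>m. h m y)" for y
  proof (cases "0 < y \<and> y < s")
    case True
    then show ?thesis
      using g_sums[of y] by (simp add: h_def deriv_f sums_iff suminf_divide)
  next
    case False
    then have "h m y = 0" for m by (auto simp: h_def)
    then show ?thesis using False by auto
  qed
  have int: "integrable lborel (h m)" for m using hint[of m] by (simp add: has_bochner_integral_iff)
  have nint: "(\<integral>y. \<bar>h m y\<bar> \<partial>lborel) = \<bar>A (Suc m)\<bar> * B m" for m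
    using habs[of m] by (simp add: has_bochner_integral_iff)
  have si: "integrable lborel (\<lambda>y. \<Sum>m. h m y)"
    using int hsum Bsum by (intro integrable_suminf) (auto simp: nint)
  have "(\<lambda>m. integral\<^sup>L lborel (h m)) sums (\<integral>y. (\<Sum>m. h m y) \<partial>lborel)"
    using int hsum Bsum by (intro sums_integral) (auto simp: nint)
  moreover have "integral\<^sup>L lborel (h m) = A (Suc m) * B m" for m
    using hint[of m] by (simp add: has_bochner_integral_iff)
  ultimately have sums: "(\<lambda>m. A (Suc m) * B m) sums (\<integral>y. (\<Sum>m. h m y) \<partial>lborel)"
    by simp
  have G1: "Gamma (1 - \<alpha>) \<noteq> 0" by (rule less_imp_neq[symmetric], rule Gamma_real_pos) (use \<alpha> in simp)
  have "integrable lborel (\<lambda>y. indicator {0<..<s} y *\<^sub>R (deriv f y / (s - y) powr \<alpha>))"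
    using si by (simp only: real_scaleR_def h_suminf)
  moreover have "f differentiable (at y)" if "0 < y" for y
    using f_deriv[OF that] real_differentiable_def by blast
  ultimately show "caputo_differentiable \<alpha> f s"
    by (simp add: caputo_differentiable_def set_integrable_def)
  have "caputo_deriv \<alpha> f s = 1 / Gamma (1 - \<alpha>) * (\<Sum>m. A (Suc m) * B m)"
    using sums by (simp only: caputo_deriv_def set_lebesgue_integral_def real_scaleR_def h_suminf sums_iff)
  also have "\<dots> = (\<Sum>m. 1 / Gamma (1 - \<alpha>) * (A (Suc m) * B m))"
    using sums by (intro suminf_mult[symmetric]) (simp add: sums_iff)
  also have "\<dots> = (\<Sum>m. A (Suc m) / Gamma (\<alpha> * real m + 1) * (s powr \<alpha>) ^ m)"
    using G1 by (simp add: B_def s_pow mult_ac)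
  finally show "caputo_deriv \<alpha> f s = (\<Sum>m. A (Suc m) / Gamma (\<alpha> * real m + 1) * (s powr \<alpha>) ^ m)" .
qed

section \<open>The Skellam distribution and its generator\<close>

text \<open>
  Extended by zero to negative indices, so that differentiation lowers the index without exception
  (\<open>DERIV_poisson_term\<close>) and no case distinction on the sign of the Skellam index is needed.
\<close>

definition poisson_term :: "int \<Rightarrow> real \<Rightarrow> real" where
  "poisson_term j x = (if j < 0 then 0 else x ^ nat j / fact (nat j))"

definition skellam_series :: "real \<Rightarrow> real \<Rightarrow> int \<Rightarrow> real \<Rightarrow> real" where
  "skellam_series l1 l2 n x = (\<Sum>b. poisson_term (n + int b) (l1 * x) * poisson_term (int b) (l2 * x))"

definition skellam_pmf :: "real \<Rightarrow> real \<Rightarrow> int \<Rightarrow> real \<Rightarrow> real" where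
  "skellam_pmf l1 l2 n x = exp (- (l1 + l2) * x) * skellam_series l1 l2 n x"

text \<open>
  The right-hand side of the forward equation of a walk on the integers with up-rate \<open>l1\<close> and down-rate
  \<open>l2\<close>.
\<close>

definition skellam_generator :: "real \<Rightarrow> real \<Rightarrow> (int \<Rightarrow> real) \<Rightarrow> int \<Rightarrow> real" where
  "skellam_generator l1 l2 f n = - (l1 + l2) * f n + l1 * f (n - 1) + l2 * f (n + 1)"

lemma DERIV_poisson_term:
  "(poisson_term j has_real_derivative poisson_term (j - 1) x) (at x)"
proof (cases "j \<le> 0")
  case True
  then have "poisson_term j = (\<lambda>_. if j = 0 then 1 else 0)"
    by (auto simp: poisson_term_def)
  with True show ?thesis by (simp add: poisson_term_def)
next
  case False
  define m where "m = nat (j - 1)"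
  have m: "j = int (Suc m)" using False by (simp add: m_def)
  have "((\<lambda>x. x ^ Suc m / fact (Suc m)) has_real_derivative real (Suc m) * x ^ m / fact (Suc m)) (at x)"
    using DERIV_cdivide[OF DERIV_pow[of "Suc m" x], of "fact (Suc m)"] by simp
  moreover have "poisson_term j = (\<lambda>x. x ^ Suc m / fact (Suc m))"
    by (auto simp: poisson_term_def m nat_add_distrib)
  moreover have "real (Suc m) * x ^ m / fact (Suc m) = poisson_term (j - 1) x"
    by (simp add: poisson_term_def m)
  ultimately show ?thesis by simp
qed

lemma abs_poisson_term_le: "\<bar>poisson_term j x\<bar> \<le> exp \<bar>x\<bar>"
proof -
  have "\<bar>x\<bar> ^ n / fact n \<le> exp \<bar>x\<bar>" for n
  proof -
    have s: "(\<lambda>n. \<bar>x\<bar> ^ n / fact n) sums exp \<bar>x\<bar>"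
      using exp_converges[of "\<bar>x\<bar>"] by (simp add: field_simps)
    have "sum (\<lambda>n. \<bar>x\<bar> ^ n / fact n) {n} \<le> (\<Sum>n. \<bar>x\<bar> ^ n / fact n)"
      using s by (intro sum_le_suminf) (auto simp: sums_iff)
    then show ?thesis using s by (simp add: sums_iff)
  qed
  then show ?thesis by (auto simp: poisson_term_def power_abs)
qed

text \<open>
  One factor is bounded crudely by an exponential; the other keeps the factorial decay that makes the
  series converge uniformly on bounded sets.
\<close>

lemma skellam_term_bound:
  assumes "\<bar>x\<bar> \<le> R" "0 \<le> a" "0 \<le> b"
  shows "\<bar>poisson_term j (a * x) * poisson_term (int k) (b * x)\<bar> \<le> exp (a * R) * ((b * R) ^ k / fact k)"
proof -
  have "\<bar>poisson_term j (a * x)\<bar> \<le> exp (a * R)"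
    using assms by (intro order_trans[OF abs_poisson_term_le]) (simp add: abs_mult mult_left_mono)
  moreover have "\<bar>poisson_term (int k) (b * x)\<bar> \<le> (b * R) ^ k / fact k"
    using assms unfolding poisson_term_def
    by (auto simp: abs_mult power_abs intro!: divide_right_mono power_mono mult_left_mono)
  ultimately show ?thesis unfolding abs_mult by (intro mult_mono) auto
qed

lemma summable_skellam_series:
  assumes "0 \<le> l1" "0 \<le> l2"
  shows "summable (\<lambda>b. poisson_term (n + int b) (l1 * x) * poisson_term (int b) (l2 * x))"
proof (rule summable_comparison_test')
  show "summable (\<lambda>b. exp (l1 * \<bar>x\<bar>) * ((l2 * \<bar>x\<bar>) ^ b / fact b))"
    using summable_exp[of "l2 * \<bar>x\<bar>"] by (intro summable_mult) (simp add: field_simps)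
  show "norm (poisson_term (n + int b) (l1 * x) * poisson_term (int b) (l2 * x))
      \<le> exp (l1 * \<bar>x\<bar>) * ((l2 * \<bar>x\<bar>) ^ b / fact b)" for b
    using skellam_term_bound[of x "\<bar>x\<bar>" l1 l2 "n + int b" b] assms by simp
qed

text \<open>
  By the product rule each term contributes one summand with the first index lowered, which belongs to
  \<open>n - 1\<close>, and one with the second index lowered, which after a shift of \<open>b\<close> belongs to \<open>n + 1\<close>.
\<close>

lemma DERIV_skellam_series:
  assumes "0 \<le> l1" "0 \<le> l2"
  shows "(skellam_series l1 l2 n has_real_derivative
    l1 * skellam_series l1 l2 (n - 1) x + l2 * skellam_series l1 l2 (n + 1) x) (at x)"
proof -
  let ?t = "\<lambda>n b x. poisson_term (n + int b) (l1 * x) * poisson_term (int b) (l2 * x)"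
  let ?u = "\<lambda>b x. poisson_term (n + int b) (l1 * x) * poisson_term (int b - 1) (l2 * x)"
  define d where "d b x = l1 * ?t (n - 1) b x + l2 * ?u b x" for b x
  define R where "R = \<bar>x\<bar> + 1"
  \<comment> \<open>\<open>?u\<close> has index \<open>- 1\<close> in its first term, which is therefore zero.\<close>
  have u0: "?u 0 x = 0" and uS: "?u (Suc b) x = ?t (n + 1) b x" for b x
    by (simp_all add: poisson_term_def[of "- 1"] algebra_simps)
  have "((\<lambda>x. \<Sum>b. ?t n b x) has_real_derivative (\<Sum>b. d b x)) (at x)"
  proof (rule has_field_derivative_series'(2)[where S="{-R<..<R}" and ?x0.0=x])
    show "((\<lambda>x. ?t n b x) has_real_derivative d b x) (at x within {-R<..<R})" for b x
    proof (rule has_field_derivative_at_within)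
      have P: "((\<lambda>x. poisson_term j (l * x)) has_real_derivative poisson_term (j - 1) (l * x) * l) (at x)"
        for j l
        by (rule DERIV_chain2[OF DERIV_poisson_term]) (rule DERIV_cmult_Id)
      show "((\<lambda>x. ?t n b x) has_real_derivative d b x) (at x)"
        by (rule DERIV_cong[OF DERIV_mult[OF P P]]) (simp add: d_def algebra_simps)
    qed
    show "uniformly_convergent_on {-R<..<R} (\<lambda>m x. \<Sum>i<m. d i x)"
    proof (rule Weierstrass_m_test')
      let ?M = "\<lambda>b. l1 * (exp (l1 * R) * ((l2 * R) ^ b / fact b)) +
          l2 * (exp (l1 * R) * (if b = 0 then 0 else (l2 * R) ^ (b - 1) / fact (b - 1)))"
      have e: "summable (\<lambda>b. (l2 * R) ^ b / fact b)"
        using summable_exp[of "l2 * R"] by (simp add: field_simps)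
      then have "summable (\<lambda>b. if b = 0 then 0 else (l2 * R) ^ (b - 1) / fact (b - 1))"
        by (subst summable_Suc_iff[symmetric]) simp
      with e show "summable ?M" by (intro summable_add summable_mult)
      show "norm (d b y) \<le> ?M b" if "y \<in> {-R<..<R}" for b y
      proof -
        have scale: "\<bar>l * z\<bar> \<le> l * B" if "\<bar>z\<bar> \<le> B" "0 \<le> l" for l z B :: real
          using that by (simp add: abs_mult mult_left_mono)
        have y: "\<bar>y\<bar> \<le> R" using that by auto
        have "\<bar>?u b y\<bar> \<le> exp (l1 * R) * (if b = 0 then 0 else (l2 * R) ^ (b - 1) / fact (b - 1))"
        proof (cases b)
          case 0 then show ?thesis using u0[of y] by simp
        next
          case (Suc k)
          then show ?thesis
            using skellam_term_bound[OF y assms, of "n + 1 + int k" k] unfolding Suc uS by simp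
        qed
        then have "\<bar>l2 * ?u b y\<bar> \<le> l2 * (exp (l1 * R) * (if b = 0 then 0 else (l2 * R) ^ (b - 1) / fact (b - 1)))"
          using assms(2) by (rule scale)
        moreover have "\<bar>l1 * ?t (n - 1) b y\<bar> \<le> l1 * (exp (l1 * R) * ((l2 * R) ^ b / fact b))"
          using skellam_term_bound[OF y assms, of "n - 1 + int b" b] assms(1) by (rule scale)
        ultimately show ?thesis
          unfolding d_def real_norm_def by (intro order_trans[OF abs_triangle_ineq] add_mono)
      qed
    qed
  qed (use summable_skellam_series[OF assms] in \<open>auto simp: R_def\<close>)
  moreover have "(\<Sum>b. d b x) = l1 * skellam_series l1 l2 (n - 1) x + l2 * skellam_series l1 l2 (n + 1) x"
  proof -
    have "(\<lambda>b. ?u (Suc b) x) sums skellam_series l1 l2 (n + 1) x"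
      unfolding uS skellam_series_def using summable_skellam_series[OF assms] by (rule summable_sums)
    then have "(\<lambda>b. ?u b x) sums skellam_series l1 l2 (n + 1) x"
      using sums_Suc_iff[of "\<lambda>b. ?u b x" "skellam_series l1 l2 (n + 1) x"] by (simp add: poisson_term_def[of "- 1"])
    moreover have "(\<lambda>b. ?t (n - 1) b x) sums skellam_series l1 l2 (n - 1) x"
      unfolding skellam_series_def using summable_skellam_series[OF assms] by (rule summable_sums)
    ultimately have "(\<lambda>b. d b x) sums (l1 * skellam_series l1 l2 (n - 1) x + l2 * skellam_series l1 l2 (n + 1) x)"
      unfolding d_def by (intro sums_add sums_mult)
    then show ?thesis by (simp add: sums_iff)
  qed
  moreover have "skellam_series l1 l2 n = (\<lambda>x. \<Sum>b. ?t n b x)"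
    by (simp add: fun_eq_iff skellam_series_def)
  ultimately show ?thesis by (simp only:)
qed

lemma DERIV_skellam_pmf:
  assumes "0 \<le> l1" "0 \<le> l2"
  shows "(skellam_pmf l1 l2 n has_real_derivative
    skellam_generator l1 l2 (\<lambda>k. skellam_pmf l1 l2 k x) n) (at x)"
proof -
  have "((\<lambda>x. exp (- (l1 + l2) * x)) has_real_derivative exp (- (l1 + l2) * x) * (- (l1 + l2))) (at x)"
    by (auto intro!: derivative_eq_intros)
  from DERIV_mult[OF this DERIV_skellam_series[OF assms, of n x]]
  have D: "(skellam_pmf l1 l2 n has_real_derivative
      exp (- (l1 + l2) * x) * (- (l1 + l2)) * skellam_series l1 l2 n x +
      (l1 * skellam_series l1 l2 (n - 1) x + l2 * skellam_series l1 l2 (n + 1) x) * exp (- (l1 + l2) * x)) (at x)"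
    unfolding skellam_pmf_def .
  have "e * (- (l1 + l2)) * u + (l1 * v + l2 * w) * e = - (l1 + l2) * (e * u) + l1 * (e * v) + l2 * (e * w)"
    for e u v w :: real
    by (simp add: algebra_simps)
  from DERIV_cong[OF D this] show ?thesis
    unfolding skellam_generator_def skellam_pmf_def .
qed

lemma DERIV_skellam_generator_funpow:
  assumes "\<And>n. ((\<lambda>x. q n x) has_real_derivative skellam_generator l1 l2 (\<lambda>k. q k x) n) (at x)"
  shows "((\<lambda>x. (skellam_generator l1 l2 ^^ m) (\<lambda>k. q k x) n) has_real_derivative
    (skellam_generator l1 l2 ^^ Suc m) (\<lambda>k. q k x) n) (at x)"
proof (induction m arbitrary: n)
  case 0
  then show ?case using assms by simp
next
  case (Suc m)
  define p where "p x = (skellam_generator l1 l2 ^^ m) (\<lambda>k. q k x)" for x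
  define p' where "p' x = (skellam_generator l1 l2 ^^ Suc m) (\<lambda>k. q k x)" for x
  have "((\<lambda>x. p x n) has_real_derivative p' x n) (at x)" for n
    unfolding p_def p'_def by (rule Suc.IH)
  then have "((\<lambda>x. skellam_generator l1 l2 (p x) n) has_real_derivative
      skellam_generator l1 l2 (p' x) n) (at x)"
    unfolding skellam_generator_def by (intro DERIV_add DERIV_cmult)
  then show ?case
    by (simp add: p_def p'_def)
qed

text \<open>
  The operator has norm at most \<open>2 (l1 + l2)\<close> on bounded sequences.
\<close>

lemma abs_skellam_generator_funpow_le:
  assumes "0 \<le> l1" "0 \<le> l2" "\<And>n. \<bar>f n\<bar> \<le> 1"
  shows "\<bar>(skellam_generator l1 l2 ^^ m) f n\<bar> \<le> (2 * (l1 + l2)) ^ m"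
proof (induction m arbitrary: n)
  case 0
  then show ?case using assms by simp
next
  case (Suc m)
  let ?g = "(skellam_generator l1 l2 ^^ m) f" and ?B = "(2 * (l1 + l2)) ^ m"
  have "\<bar>skellam_generator l1 l2 ?g n\<bar> \<le> \<bar>(l1 + l2) * ?g n\<bar> + \<bar>l1 * ?g (n - 1)\<bar> + \<bar>l2 * ?g (n + 1)\<bar>"
    unfolding skellam_generator_def by linarith
  also have "\<dots> = (l1 + l2) * \<bar>?g n\<bar> + l1 * \<bar>?g (n - 1)\<bar> + l2 * \<bar>?g (n + 1)\<bar>"
    using assms by (simp add: abs_mult)
  also have "\<dots> \<le> (l1 + l2) * ?B + l1 * ?B + l2 * ?B"
    using assms by (intro add_mono mult_left_mono Suc.IH) auto
  also have "\<dots> = (2 * (l1 + l2)) ^ Suc m" by (simp add: algebra_simps)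
  finally show ?case by simp
qed

text \<open>
  The derivative of order \<open>m\<close> at any \<open>y \<ge> 0\<close> is the \<open>m\<close>-th power of the generator applied to the values at
  \<open>y\<close>. As these are bounded by \<open>1\<close>, it is at most \<open>(2 (l1 + l2))\<^sup>m\<close>, so the remainder in Taylor's formula
  tends to zero. The bound by \<open>1\<close> is left as an assumption because its natural proof is that the values are
  probabilities (\<open>skellam_pmf_bounds\<close>).
\<close>

lemma skellam_pmf_power_series:
  assumes "0 \<le> l1" "0 \<le> l2" and bnd: "\<And>n x. 0 \<le> x \<Longrightarrow> \<bar>skellam_pmf l1 l2 n x\<bar> \<le> 1" and "0 \<le> x"
  shows "(\<lambda>m. (skellam_generator l1 l2 ^^ m) (\<lambda>k. skellam_pmf l1 l2 k 0) n / fact m * x ^ m)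
    sums skellam_pmf l1 l2 n x"
proof (cases "x = 0")
  case True
  have "(\<lambda>m. (skellam_generator l1 l2 ^^ m) (\<lambda>k. skellam_pmf l1 l2 k 0) n / fact m * 0 ^ m)
    sums ((skellam_generator l1 l2 ^^ 0) (\<lambda>k. skellam_pmf l1 l2 k 0) n / fact 0)"
    by (rule powser_sums_zero)
  then show ?thesis using True by simp
next
  case False
  define D where "D m y = (skellam_generator l1 l2 ^^ m) (\<lambda>k. skellam_pmf l1 l2 k y) n" for m y
  let ?K = "2 * (l1 + l2)"
  have rem: "\<bar>skellam_pmf l1 l2 n x - (\<Sum>m<N. D m 0 / fact m * x ^ m)\<bar> \<le> (?K * x) ^ N / fact N" for N
  proof -
    have "\<exists>t. 0 < t \<and> t \<le> x \<and> skellam_pmf l1 l2 n x =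
        (\<Sum>m<N. D m 0 / fact m * x ^ m) + D N t / fact N * x ^ N"
    proof (rule Maclaurin2)
      show "\<forall>m t. m < N \<and> 0 \<le> t \<and> t \<le> x \<longrightarrow> DERIV (D m) t :> D (Suc m) t"
        unfolding D_def[abs_def]
        using DERIV_skellam_generator_funpow[OF DERIV_skellam_pmf[OF assms(1,2)]] by blast
    qed (use False \<open>0 \<le> x\<close> in \<open>auto simp: D_def\<close>)
    then obtain t where t: "0 < t" "skellam_pmf l1 l2 n x =
        (\<Sum>m<N. D m 0 / fact m * x ^ m) + D N t / fact N * x ^ N" by blast
    have "\<bar>D N t\<bar> \<le> ?K ^ N"
      unfolding D_def using assms t(1) by (intro abs_skellam_generator_funpow_le bnd) auto
    then show ?thesis
      using t(2) \<open>0 \<le> x\<close> by (simp add: abs_mult power_mult_distrib divide_right_mono mult_right_mono)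
  qed
  have "(\<lambda>N. (?K * x) ^ N / fact N) \<longlonglongrightarrow> 0"
    using summable_LIMSEQ_zero[OF summable_exp[of "?K * x"]] by (simp add: field_simps)
  then have "(\<lambda>N. skellam_pmf l1 l2 n x - (\<Sum>m<N. D m 0 / fact m * x ^ m)) \<longlonglongrightarrow> 0"
    by (rule Lim_null_comparison[rotated]) (use rem in \<open>simp only: real_norm_def eventually_True simp_thms\<close>)
  from tendsto_diff[OF tendsto_const[of "skellam_pmf l1 l2 n x"] this]
  show ?thesis by (simp add: sums_def D_def)
qed

text \<open>
  For \<open>n \<ge> 0\<close> the terms agree one by one, with \<open>k = b\<close>. For \<open>n < 0\<close> the first \<open>|n|\<close> terms of the series
  vanish and \<open>k = b - |n|\<close>. The powers of \<open>l1\<close> and \<open>l2\<close> are symmetrised by means of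
  \<open>(l1 / l2)\<^bsup>n/2\<^esup> (l1 l2)\<^bsup>|n|/2\<^esup>\<close>, which is \<open>l1\<^bsup>|n|\<^esup>\<close> or \<open>l2\<^bsup>|n|\<^esup>\<close>.
\<close>

lemma skellam_series_closed_form:
  assumes "0 < l1" "0 < l2"
  shows "(\<lambda>k. (l1 / l2) powr (real_of_int n / 2) * ((sqrt (l1 * l2) * x) ^ (nat \<bar>n\<bar> + 2 * k) /
      (fact (nat \<bar>n\<bar> + k) * fact k))) sums skellam_series l1 l2 n x"
proof -
  let ?t = "\<lambda>b. poisson_term (n + int b) (l1 * x) * poisson_term (int b) (l2 * x)"
  let ?c = "\<lambda>k. (l1 / l2) powr (real_of_int n / 2) * ((sqrt (l1 * l2) * x) ^ (nat \<bar>n\<bar> + 2 * k) /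
      (fact (nat \<bar>n\<bar> + k) * fact k))"
  have S: "?t sums skellam_series l1 l2 n x"
    unfolding skellam_series_def using summable_skellam_series[of l1 l2] assms by (intro summable_sums) auto
  have sq: "sqrt (l1 * l2) ^ (2 * k) = (l1 * l2) ^ k" for k
    using assms by (simp add: power_mult)
  have half: "(l1 / l2) powr (real m / 2) = sqrt l1 ^ m / sqrt l2 ^ m" for m
  proof -
    have "(l1 / l2) powr (real m / 2) = ((l1 / l2) powr (1 / 2)) powr real m"
      by (simp add: powr_powr)
    then show ?thesis using assms by (simp add: powr_half_sqrt powr_realpow real_sqrt_divide power_divide)
  qed
  have cancel: "sqrt a ^ m / sqrt b ^ m * sqrt (a * b) ^ m = a ^ m" if "0 < a" "0 < b" for a b :: real and m
  proof -
    have "sqrt a ^ m / sqrt b ^ m * sqrt (a * b) ^ m = (sqrt a / sqrt b * sqrt (a * b)) ^ m"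
      by (simp only: power_divide power_mult_distrib)
    moreover have "sqrt a / sqrt b * sqrt (a * b) = a"
      using that by (simp add: real_sqrt_mult)
    ultimately show ?thesis by simp
  qed
  have expand: "P * ((sqrt (l1 * l2) * x) ^ (m + 2 * k) / F) =
      P * sqrt (l1 * l2) ^ m * ((l1 * l2) ^ k * x ^ (m + 2 * k) / F)" for P F :: real and m k
    by (simp only: power_mult_distrib[of "sqrt (l1 * l2)"] power_add[of "sqrt (l1 * l2)"] sq
        times_divide_eq_right mult.assoc)
  show ?thesis
  proof (cases "0 \<le> n")
    case True
    define m where "m = nat n"
    have n: "n = int m" using True by (simp add: m_def)
    have "?c k = ?t k" for k
    proof -
      have "?c k = l1 ^ m * ((l1 * l2) ^ k * x ^ (m + 2 * k) / (fact (m + k) * fact k))"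
        using half[of m] cancel[OF assms, of m] by (simp only: n abs_of_nat nat_int of_int_of_nat_eq expand)
      also have "\<dots> = ?t k"
        by (simp add: poisson_term_def n power_mult_distrib power_add mult_2 nat_add_distrib)
      finally show ?thesis .
    qed
    then show ?thesis using S by simp
  next
    case False
    define m where "m = nat (- n)"
    have n: "n = - int m" using False by (simp add: m_def)
    have p: "(l1 / l2) powr (real_of_int (- int m) / 2) = sqrt l2 ^ m / sqrt l1 ^ m"
      using half[of m] assms by (simp add: powr_minus)
    have "?c k = ?t (k + m)" for k
    proof -
      have "?c k = l2 ^ m * ((l1 * l2) ^ k * x ^ (m + 2 * k) / (fact (m + k) * fact k))"
        using cancel[OF assms(2,1), of m]
        by (simp only: n abs_minus_cancel abs_of_nat nat_int expand p mult.commute[of l2 l1])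
      also have "\<dots> = ?t (k + m)"
        by (simp add: poisson_term_def n power_mult_distrib power_add mult_2 mult_2_right nat_add_distrib add_ac mult_ac)
      finally show ?thesis .
    qed
    moreover have "(\<Sum>i<m. ?t i) = 0"
      by (intro sum.neutral) (auto simp: poisson_term_def n)
    then have "(\<lambda>k. ?t (k + m)) sums skellam_series l1 l2 n x"
      using sums_split_initial_segment[OF S, of m] by simp
    ultimately show ?thesis by simp
  qed
qed

section \<open>Distributions determined by moments and Laplace transforms\<close>

text \<open>
  On \<open>[-1, 1]\<close> the moments are bounded, so the characteristic function is the limit of its Taylor
  polynomials, whose coefficients are the moments.
\<close>

lemma real_distribution_eqI_moments:
  assumes "real_distribution M1" "real_distribution M2"
    and bnd: "AE x in M1. \<bar>x\<bar> \<le> 1" "AE x in M2. \<bar>x\<bar> \<le> 1"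
    and mom: "\<And>k. (\<integral>x. x ^ k \<partial>M1) = (\<integral>x. x ^ k \<partial>M2)"
  shows "M1 = M2"
proof (rule Levy_uniqueness[OF assms(1,2)], rule ext)
  fix t :: real
  define T where "T n = (\<Sum>k\<le>n. ((\<i> * t) ^ k / fact k) * complex_of_real (\<integral>x. x ^ k \<partial>M1))" for n
  have lim: "T \<longlonglongrightarrow> char M t"
    if "real_distribution M" "AE x in M. \<bar>x\<bar> \<le> 1" "\<And>k. (\<integral>x. x ^ k \<partial>M) = (\<integral>x. x ^ k \<partial>M1)"
    for M
  proof -
    interpret real_distribution M by fact
    have int: "integrable M (\<lambda>x. x ^ k)" for k
      using that(2) by (intro integrable_const_bound[of _ 1]) (auto simp: power_abs power_le_one)
    have le: "expectation (\<lambda>x. \<bar>x\<bar> ^ n) \<le> 1" for n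
    proof -
      have "expectation (\<lambda>x. \<bar>x\<bar> ^ n) \<le> expectation (\<lambda>x. 1)"
        using that(2) by (intro integral_mono_AE integrable_const_bound[of _ 1]) (auto simp: power_le_one)
      then show ?thesis by (simp add: prob_space del: space_eq_univ)
    qed
    have bound: "norm (char M t - T n) \<le> 2 * (\<bar>t\<bar> ^ n / fact n)" for n
    proof -
      have "norm (char M t - T n) \<le> (2 * \<bar>t\<bar> ^ n / fact n) * expectation (\<lambda>x. \<bar>x\<bar> ^ n)"
        using char_approx1[of n t] int by (simp add: T_def that(3))
      also have "\<dots> \<le> (2 * \<bar>t\<bar> ^ n / fact n) * 1"
        by (intro mult_left_mono le) auto
      finally show ?thesis by simp
    qed
    have "(\<lambda>n. \<bar>t\<bar> ^ n / fact n) \<longlonglongrightarrow> 0"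
      using summable_LIMSEQ_zero[OF summable_exp[of "\<bar>t\<bar>"]] by (simp add: field_simps)
    then have "(\<lambda>n. 2 * (\<bar>t\<bar> ^ n / fact n)) \<longlonglongrightarrow> 0"
      by (rule tendsto_mult_right_zero)
    then have "(\<lambda>n. char M t - T n) \<longlonglongrightarrow> 0"
      by (rule Lim_null_comparison[rotated]) (use bound in \<open>simp only: eventually_True simp_thms\<close>)
    from tendsto_diff[OF tendsto_const[of "char M t"] this] show ?thesis
      by simp
  qed
  show "char M1 t = char M2 t"
    using lim[OF assms(1) bnd(1)] lim[OF assms(2) bnd(2)] mom by (metis LIMSEQ_unique)
qed

text \<open>
  The strict inequality \<open>x < y\<close> leaves room for atoms; right-continuity closes the gap.
\<close>

lemma real_distribution_eqI_cdf:
  assumes "real_distribution M1" "real_distribution M2"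
    and le: "\<And>x y. x < y \<Longrightarrow> cdf M1 x \<le> cdf M2 y" "\<And>x y. x < y \<Longrightarrow> cdf M2 x \<le> cdf M1 y"
  shows "M1 = M2"
proof (rule cdf_unique[OF assms(1,2)], rule ext)
  fix x
  interpret M1: real_distribution M1 by fact
  interpret M2: real_distribution M2 by fact
  have "cdf M1 x \<le> cdf M2 x"
  proof (rule tendsto_lowerbound)
    show "(cdf M2 \<longlongrightarrow> cdf M2 x) (at_right x)"
      using M2.cdf_is_right_cont[of x] by (simp add: continuous_within)
    show "\<forall>\<^sub>F y in at_right x. cdf M1 x \<le> cdf M2 y"
      by (rule eventually_at_right_less[THEN eventually_mono]) (rule le)
  qed simp
  moreover have "cdf M2 x \<le> cdf M1 x"
  proof (rule tendsto_lowerbound)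
    show "(cdf M1 \<longlongrightarrow> cdf M1 x) (at_right x)"
      using M1.cdf_is_right_cont[of x] by (simp add: continuous_within)
    show "\<forall>\<^sub>F y in at_right x. cdf M2 x \<le> cdf M1 y"
      by (rule eventually_at_right_less[THEN eventually_mono]) (rule le)
  qed simp
  ultimately show "cdf M1 x = cdf M2 x" by simp
qed

text \<open>
  The Laplace transform at the integers lists the moments of \<open>exp (-X)\<close>, which takes values in \<open>[0, 1]\<close> and
  determines \<open>X\<close>.
\<close>

lemma (in prob_space) distr_eqI_laplace:
  fixes X Y :: "'a \<Rightarrow> real"
  assumes [measurable]: "random_variable borel X" "random_variable borel Y"
    and nonneg: "AE \<omega> in M. 0 \<le> X \<omega>" "AE \<omega> in M. 0 \<le> Y \<omega>"
    and laplace: "\<And>k::nat. 0 < k \<Longrightarrow> expectation (\<lambda>\<omega>. exp (- real k * X \<omega>)) = expectation (\<lambda>\<omega>. exp (- real k * Y \<omega>))"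
  shows "distr M borel X = distr M borel Y"
proof -
  have mom: "(\<integral>u. u ^ k \<partial>distr M borel (\<lambda>\<omega>. exp (- X \<omega>))) = (\<integral>u. u ^ k \<partial>distr M borel (\<lambda>\<omega>. exp (- Y \<omega>)))"
    for k :: nat
    using laplace[of k] by (cases "k = 0") (simp_all add: integral_distr exp_of_nat_mult[symmetric] measure_distr)
  have "distr M borel (\<lambda>\<omega>. exp (- X \<omega>)) = distr M borel (\<lambda>\<omega>. exp (- Y \<omega>))"
    by (rule real_distribution_eqI_moments[OF _ _ _ _ mom])
      (use nonneg in \<open>auto intro!: real_distribution_distr simp: AE_distr_iff\<close>)
  then have "distr (distr M borel (\<lambda>\<omega>. exp (- X \<omega>))) borel (\<lambda>u. - ln u) =
      distr (distr M borel (\<lambda>\<omega>. exp (- Y \<omega>))) borel (\<lambda>u. - ln u)"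
    by simp
  then show ?thesis
    by (subst (asm) (1 2) distr_distr) (auto simp: comp_def)
qed

section \<open>Two Gamma integrals\<close>

lemma nn_integral_Gamma_scaled:
  fixes a h :: real
  assumes "0 < a" "0 < h"
  shows "(\<integral>\<^sup>+w. ennreal (indicator {0..} w * w powr (a - 1) * exp (- w * h)) \<partial>lborel)
    = ennreal (Gamma a * h powr (- a))"
proof -
  have "(\<integral>\<^sup>+w. ennreal (indicator {0..} w * w powr (a - 1) * exp (- w * h)) \<partial>lborel) =
      ennreal (1 / h) * (\<integral>\<^sup>+w. ennreal (indicator {0..} (w / h) * (w / h) powr (a - 1) * exp (- w)) \<partial>lborel)"
    using assms by (subst nn_integral_real_affine[where c="1 / h" and t=0]) (auto simp: field_simps)
  also have "(\<lambda>w. ennreal (indicator {0..} (w / h) * (w / h) powr (a - 1) * exp (- w))) =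
      (\<lambda>w. ennreal (h powr (1 - a)) * ennreal (indicator {0..} w * w powr (a - 1) / exp w))"
    using assms by (auto simp: fun_eq_iff indicator_def powr_divide powr_diff exp_minus field_simps zero_le_divide_iff
        simp flip: ennreal_mult')
  also have "(\<integral>\<^sup>+w. ennreal (h powr (1 - a)) * ennreal (indicator {0..} w * w powr (a - 1) / exp w) \<partial>lborel) =
      ennreal (h powr (1 - a)) * ennreal (Gamma a)"
    using assms by (simp add: nn_integral_cmult Gamma_conv_nn_integral_real)
  also have "ennreal (1 / h) * (ennreal (h powr (1 - a)) * ennreal (Gamma a)) =
      ennreal (1 / h * h powr (1 - a) * Gamma a)"
    using assms by (simp add: mult.assoc flip: ennreal_mult')
  also have "1 / h * h powr (1 - a) * Gamma a = Gamma a * h powr (- a)"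
    using assms by (simp add: powr_diff powr_minus field_simps)
  finally show ?thesis .
qed

text \<open>
  The substitution \<open>u = w\<^sup>\<alpha>\<close> turns the integrand into \<open>u\<^bsup>m - 1\<^esup> exp (-u) / \<alpha>\<close>, whose antiderivative \<open>G\<close> is
  elementary because \<open>m\<close> is an integer.
\<close>

lemma nn_integral_powr_exp_powr:
  fixes \<alpha> :: real
  assumes "0 < \<alpha>" "0 < m"
  shows "(\<integral>\<^sup>+w. ennreal (indicator {0..} w * w powr (\<alpha> * real m - 1) * exp (- (w powr \<alpha>))) \<partial>lborel)
    = ennreal (fact (m - 1) / \<alpha>)"
proof -
  define G where "G u = - exp (- u) * (\<Sum>j<m. u ^ j / fact j)" for u :: real
  define F where "F w = fact (m - 1) / \<alpha> * G (w powr \<alpha>)" for w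
  define f where "f w = w powr (\<alpha> * real m - 1) * exp (- (w powr \<alpha>))" for w
  have dsum: "((\<lambda>u::real. \<Sum>j<Suc k. u ^ j / fact j) has_real_derivative (\<Sum>j<k. u ^ j / fact j)) (at u)" for k u
  proof (induction k)
    case (Suc k)
    have "((\<lambda>u::real. u ^ Suc k / fact (Suc k)) has_real_derivative u ^ k / fact k) (at u)"
      using DERIV_cdivide[OF DERIV_pow[of "Suc k" u], of "fact (Suc k)"] by simp
    from DERIV_add[OF Suc this] show ?case by simp
  qed simp
  obtain k where k: "m = Suc k" using assms(2) gr0_conv_Suc by blast
  have DG: "(G has_real_derivative exp (- u) * (u ^ (m - 1) / fact (m - 1))) (at u)" for u
  proof -
    have "((\<lambda>u::real. - exp (- u)) has_real_derivative exp (- u)) (at u)"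
      by (auto intro!: derivative_eq_intros)
    from DERIV_mult[OF this dsum[of k u]]
    have "(G has_real_derivative exp (- u) * (\<Sum>j<Suc k. u ^ j / fact j) + (\<Sum>j<k. u ^ j / fact j) * - exp (- u)) (at u)"
      by (simp only: G_def[abs_def] k)
    then show ?thesis by (rule DERIV_cong) (simp add: k algebra_simps)
  qed
  have DF: "(F has_real_derivative f w) (at w)" if "0 < w" for w
  proof -
    have "((\<lambda>w. G (w powr \<alpha>)) has_real_derivative
        exp (- (w powr \<alpha>)) * ((w powr \<alpha>) ^ (m - 1) / fact (m - 1)) * (\<alpha> * w powr (\<alpha> - 1))) (at w)"
      by (rule DERIV_chain2[OF DG has_real_derivative_powr[OF that]])
    then have "(F has_real_derivative fact (m - 1) / \<alpha> *
        (exp (- (w powr \<alpha>)) * ((w powr \<alpha>) ^ (m - 1) / fact (m - 1)) * (\<alpha> * w powr (\<alpha> - 1)))) (at w)"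
      unfolding F_def by (rule DERIV_cmult)
    moreover have "(w powr \<alpha>) ^ (m - 1) * w powr (\<alpha> - 1) = w powr (\<alpha> * real m - 1)"
    proof -
      have "(w powr \<alpha>) ^ k = w powr (\<alpha> * real k)"
        using that by (simp add: powr_powr flip: powr_realpow)
      then show ?thesis by (simp add: k algebra_simps flip: powr_add)
    qed
    then have "fact (m - 1) / \<alpha> *
        (exp (- (w powr \<alpha>)) * ((w powr \<alpha>) ^ (m - 1) / fact (m - 1)) * (\<alpha> * w powr (\<alpha> - 1))) = f w"
      using assms(1) by (simp add: f_def)
    ultimately show ?thesis by simp
  qed
  have f_cont: "isCont f w" if "0 < w" for w
    unfolding f_def using that by (auto intro!: continuous_intros)
  have lim0: "((F \<circ> real_of_ereal) \<longlongrightarrow> - (fact (m - 1) / \<alpha>)) (at_right (ereal 0))"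
    unfolding ereal_tendsto_simps
  proof -
    have G0: "G 0 = - 1"
    proof -
      have "(\<Sum>j<m. (0::real) ^ j / fact j) = 1"
        unfolding k lessThan_Suc_eq_insert_0 by (simp add: sum.reindex)
      then show ?thesis by (simp add: G_def)
    qed
    have "((\<lambda>w. w powr \<alpha>) \<longlongrightarrow> 0) (at_right 0)"
      using assms(1) by (intro tendsto_powr'[where b=\<alpha> and a=0, simplified] tendsto_intros) (auto simp: eventually_at_right_less less_imp_le eventually_mono[OF eventually_at_right_less])
    then have "((\<lambda>w. G (w powr \<alpha>)) \<longlongrightarrow> G 0) (at_right 0)"
      by (rule isCont_tendsto_compose[OF DERIV_isCont[OF DG]])
    then show "(F \<longlongrightarrow> - (fact (m - 1) / \<alpha>)) (at_right 0)"
      unfolding F_def G0 using assms(1) by (auto intro!: tendsto_eq_intros)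
  qed
  have liminf: "((F \<circ> real_of_ereal) \<longlongrightarrow> 0) (at_left \<infinity>)"
    unfolding ereal_tendsto_simps
  proof -
    have "((\<lambda>u::real. u ^ j / exp u / fact j) \<longlongrightarrow> 0) at_top" for j
      using tendsto_divide[OF tendsto_power_div_exp_0[of j] tendsto_const[of "fact j"]] by simp
    then have "((\<lambda>u::real. - (\<Sum>j<m. u ^ j / exp u / fact j)) \<longlongrightarrow> - (\<Sum>j<m. 0)) at_top"
      by (intro tendsto_minus tendsto_sum)
    then have "(G \<longlongrightarrow> 0) at_top"
      by (simp add: G_def[abs_def] sum_distrib_left exp_minus field_simps sum_negf)
    moreover have "LIM w at_top. w powr \<alpha> :> at_top"
      using assms(1) by real_asymp
    ultimately have "((\<lambda>w. G (w powr \<alpha>)) \<longlongrightarrow> 0) at_top"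
      by (rule filterlim_compose)
    then show "(F \<longlongrightarrow> 0) at_top"
      unfolding F_def by (rule tendsto_mult_right_zero)
  qed
  have int: "set_integrable lborel (einterval (ereal 0) \<infinity>) f"
    and val: "(LBINT w=ereal 0..\<infinity>. f w) = 0 - - (fact (m - 1) / \<alpha>)"
    by (rule interval_integral_FTC_nonneg[OF _ DF f_cont _ lim0 liminf]; simp add: f_def)+
  have "(\<integral>\<^sup>+w. ennreal (indicator {0..} w * w powr (\<alpha> * real m - 1) * exp (- (w powr \<alpha>))) \<partial>lborel) =
      (\<integral>\<^sup>+w. ennreal (indicator {0<..} w *\<^sub>R f w) \<partial>lborel)"
    by (intro nn_integral_cong) (auto simp: f_def indicator_def)
  also have "\<dots> = ennreal (LBINT w:{0<..}. f w)"
    unfolding set_lebesgue_integral_def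
    using int by (intro nn_integral_eq_integral) (auto simp: set_integrable_def f_def)
  also have "(LBINT w:{0<..}. f w) = fact (m - 1) / \<alpha>"
    using val interval_integral_to_infinity_eq[where a=0 and f=f and M=lborel] by simp
  finally show ?thesis .
qed

section \<open>Laplace transform and negative moments of the stable subordinator\<close>

context prob_space
begin

text \<open>
  Otherwise the integral would have the default value \<open>0\<close>, but the Laplace transform is positive.
\<close>

lemma stable_subordinator_integrable:
  assumes "stable_subordinator \<alpha> H" "0 \<le> x" "0 < w"
  shows "integrable M (\<lambda>\<omega>. exp (- w * H x \<omega>))"
  using assms not_integrable_integral_eq[of M "\<lambda>\<omega>. exp (- w * H x \<omega>)"]
  unfolding stable_subordinator_def by force

lemma stable_subordinator_laplace:
  assumes "stable_subordinator \<alpha> H" "0 \<le> x" "0 < w"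
  shows "expectation (\<lambda>\<omega>. exp (- w * H x \<omega>)) = exp (- x * w powr \<alpha>)"
  using assms unfolding stable_subordinator_def by blast

lemma stable_subordinator_measurable:
  assumes "stable_subordinator \<alpha> H" "0 \<le> x"
  shows "random_variable borel (H x)"
  using assms unfolding stable_subordinator_def levy_process_def by blast

lemma stable_subordinator_mono:
  assumes "stable_subordinator \<alpha> H" "\<omega> \<in> space M" "0 \<le> x" "x \<le> y"
  shows "H x \<omega> \<le> H y \<omega>"
  using assms unfolding stable_subordinator_def mono_on_def by simp

lemma stable_subordinator_chernoff:
  assumes "stable_subordinator \<alpha> H" "0 \<le> x" "0 < w"
  shows "prob {\<omega> \<in> space M. H x \<omega> \<le> s} \<le> exp (w * s - x * w powr \<alpha>)"
proof -
  have [measurable]: "random_variable borel (H x)"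
    using assms stable_subordinator_measurable by blast
  have "prob {\<omega> \<in> space M. H x \<omega> \<le> s} = expectation (indicator {\<omega> \<in> space M. H x \<omega> \<le> s})"
    by simp
  also have "\<dots> \<le> expectation (\<lambda>\<omega>. exp (w * s) * exp (- w * H x \<omega>))"
  proof (rule integral_mono)
    show "integrable M (indicat_real {\<omega> \<in> space M. H x \<omega> \<le> s})"
      by (intro integrable_real_indicator) (auto simp: emeasure_eq_measure)
    show "integrable M (\<lambda>\<omega>. exp (w * s) * exp (- w * H x \<omega>))"
      using stable_subordinator_integrable[OF assms] by (rule integrable_mult_right)
    fix \<omega> assume "\<omega> \<in> space M"
    have "1 \<le> exp (w * s) * exp (- w * H x \<omega>)" if "H x \<omega> \<le> s"
      using that assms(3) by (simp flip: exp_add)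
    then show "indicator {\<omega> \<in> space M. H x \<omega> \<le> s} \<omega> \<le> exp (w * s) * exp (- w * H x \<omega>)"
      by (simp add: indicator_def)
  qed
  also have "\<dots> = exp (w * s) * expectation (\<lambda>\<omega>. exp (- w * H x \<omega>))"
    by (rule integral_mult_right_zero)
  also have "\<dots> = exp (w * s - x * w powr \<alpha>)"
    unfolding stable_subordinator_laplace[OF assms] by (simp flip: exp_add)
  finally show ?thesis .
qed

text \<open>
  As \<open>w\<close> tends to infinity, the Chernoff bound for the event \<open>H x \<le> 0\<close> tends to zero.
\<close>

lemma stable_subordinator_pos:
  assumes "stable_subordinator \<alpha> H" "0 < \<alpha>" "0 < x"
  shows "AE \<omega> in M. 0 < H x \<omega>"
proof -
  have [measurable]: "random_variable borel (H x)"
    using assms stable_subordinator_measurable less_imp_le by blast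
  have "LIM w at_top. - x * w powr \<alpha> :> at_bot"
    using assms(2,3) by real_asymp
  then have "((\<lambda>w. exp (- x * w powr \<alpha>)) \<longlongrightarrow> 0) at_top"
    by (rule filterlim_compose[OF exp_at_bot])
  moreover have "\<forall>\<^sub>F w in at_top. prob {\<omega> \<in> space M. H x \<omega> \<le> 0} \<le> exp (- x * w powr \<alpha>)"
    using eventually_gt_at_top[of 0]
    by eventually_elim (use stable_subordinator_chernoff[OF assms(1), of x _ 0] assms(3) in simp)
  ultimately have "prob {\<omega> \<in> space M. H x \<omega> \<le> 0} \<le> 0"
    by (intro tendsto_lowerbound[where F="at_top :: real filter"]) auto
  then have "prob {\<omega> \<in> space M. H x \<omega> \<le> 0} = 0"
    using measure_nonneg[of M "{\<omega> \<in> space M. H x \<omega> \<le> 0}"] by linarith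
  then have "AE \<omega> in M. \<omega> \<notin> {\<omega> \<in> space M. H x \<omega> \<le> 0}"
    by (subst (asm) prob_eq_0) auto
  then show ?thesis by (auto simp: not_le elim: AE_mp)
qed

lemma stable_subordinator_unbounded:
  assumes "stable_subordinator \<alpha> H"
  shows "AE \<omega> in M. \<exists>n::nat. s < H (real n + 1) \<omega>"
proof -
  have [measurable]: "random_variable borel (H (real n + 1))" for n :: nat
    using assms stable_subordinator_measurable by simp
  define B where "B = {\<omega> \<in> space M. \<forall>n::nat. H (real n + 1) \<omega> \<le> s}"
  have [measurable]: "B \<in> events" unfolding B_def by measurable
  have "prob B \<le> exp (s - (real n + 1))" for n :: nat
  proof -
    have "prob B \<le> prob {\<omega> \<in> space M. H (real n + 1) \<omega> \<le> s}"
      by (intro finite_measure_mono) (auto simp: B_def)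
    also have "\<dots> \<le> exp (s - (real n + 1))"
      using stable_subordinator_chernoff[OF assms, of "real n + 1" 1 s] by simp
    finally show ?thesis .
  qed
  moreover have "(\<lambda>n. exp (s - (real n + 1))) \<longlonglongrightarrow> 0"
    by real_asymp
  ultimately have "prob B \<le> 0"
    by (intro LIMSEQ_le_const) auto
  then have "prob B = 0"
    using measure_nonneg[of M B] by linarith
  then have "AE \<omega> in M. \<omega> \<notin> B"
    by (subst (asm) prob_eq_0) auto
  then show ?thesis by (auto simp: B_def not_le elim: AE_mp)
qed

lemma stable_subordinator_self_similar:
  assumes "stable_subordinator \<alpha> H" "0 < \<alpha>" "0 < x"
  shows "distr M borel (H x) = distr M borel (\<lambda>\<omega>. x powr (1 / \<alpha>) * H 1 \<omega>)"
proof (rule distr_eqI_laplace)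
  have [measurable]: "random_variable borel (H 1)"
    using assms stable_subordinator_measurable by simp
  show "random_variable borel (H x)" "random_variable borel (\<lambda>\<omega>. x powr (1 / \<alpha>) * H 1 \<omega>)"
    using assms stable_subordinator_measurable less_imp_le by (blast, measurable)
  show "AE \<omega> in M. 0 \<le> H x \<omega>"
    using stable_subordinator_pos[OF assms] by eventually_elim simp
  show "AE \<omega> in M. 0 \<le> x powr (1 / \<alpha>) * H 1 \<omega>"
    using stable_subordinator_pos[OF assms(1,2), of 1] by (auto elim: eventually_mono)
  fix k :: nat assume k: "0 < k"
  have "expectation (\<lambda>\<omega>. exp (- (real k * x powr (1 / \<alpha>)) * H 1 \<omega>)) =
      exp (- 1 * (real k * x powr (1 / \<alpha>)) powr \<alpha>)"
    using assms k by (intro stable_subordinator_laplace) auto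
  also have "(real k * x powr (1 / \<alpha>)) powr \<alpha> = x * real k powr \<alpha>"
    using assms k by (simp add: powr_mult powr_powr)
  finally show "expectation (\<lambda>\<omega>. exp (- real k * H x \<omega>)) =
      expectation (\<lambda>\<omega>. exp (- real k * (x powr (1 / \<alpha>) * H 1 \<omega>)))"
    using stable_subordinator_laplace[OF assms(1), of x "real k"] assms k by (simp add: mult.assoc)
qed

text \<open>
  Write \<open>\<Gamma>(\<alpha>m) H(1)\<^bsup>-\<alpha>m\<^esup>\<close> as the integral of \<open>w\<^bsup>\<alpha>m - 1\<^esup> exp (-w H(1))\<close> over \<open>w > 0\<close>. By Tonelli's
  theorem the expectation replaces \<open>exp (-w H(1))\<close> by \<open>exp (-w\<^sup>\<alpha>)\<close>, and the resulting integral is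
  \<open>(m - 1)! / \<alpha>\<close>.
\<close>

lemma stable_subordinator_negative_moments:
  assumes H: "stable_subordinator \<alpha> H" and \<alpha>: "0 < \<alpha>"
  shows "integrable M (\<lambda>\<omega>. (H 1 \<omega> powr (- \<alpha>)) ^ m)"
    and "expectation (\<lambda>\<omega>. (H 1 \<omega> powr (- \<alpha>)) ^ m) = fact m / Gamma (\<alpha> * real m + 1)"
proof -
  have [measurable]: "random_variable borel (H 1)"
    using H stable_subordinator_measurable by simp
  have "integrable M (\<lambda>\<omega>. (H 1 \<omega> powr (- \<alpha>)) ^ m) \<and>
    expectation (\<lambda>\<omega>. (H 1 \<omega> powr (- \<alpha>)) ^ m) = fact m / Gamma (\<alpha> * real m + 1)"
  proof (cases "m = 0")
    case True
    then show ?thesis by (simp add: prob_space)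
  next
    case False
    define a where "a = \<alpha> * real m"
    have a: "0 < a" using False \<alpha> by (simp add: a_def)
    have Ga: "0 < Gamma a" using a by (rule Gamma_real_pos)
    have "(\<integral>\<^sup>+\<omega>. ennreal (Gamma a * (H 1 \<omega> powr (- \<alpha>)) ^ m) \<partial>M) =
        (\<integral>\<^sup>+\<omega>. (\<integral>\<^sup>+w. ennreal (indicator {0..} w * w powr (a - 1) * exp (- w * H 1 \<omega>)) \<partial>lborel) \<partial>M)"
    proof (rule nn_integral_cong_AE)
      show "AE \<omega> in M. ennreal (Gamma a * (H 1 \<omega> powr (- \<alpha>)) ^ m) =
          (\<integral>\<^sup>+w. ennreal (indicator {0..} w * w powr (a - 1) * exp (- w * H 1 \<omega>)) \<partial>lborel)"
        using stable_subordinator_pos[OF H \<alpha>, of 1, OF zero_less_one]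
      proof eventually_elim
        case (elim \<omega>)
        then have "(H 1 \<omega> powr (- \<alpha>)) ^ m = H 1 \<omega> powr (- a)"
          by (simp add: a_def powr_powr flip: powr_realpow)
        then show ?case using nn_integral_Gamma_scaled[OF a elim] by simp
      qed
    qed
    also have "\<dots> = (\<integral>\<^sup>+w. (\<integral>\<^sup>+\<omega>. ennreal (indicator {0..} w * w powr (a - 1) * exp (- w * H 1 \<omega>)) \<partial>M) \<partial>lborel)"
    proof -
      interpret pair_sigma_finite M lborel ..
      show ?thesis by (intro Fubini'[symmetric]) measurable
    qed
    also have "\<dots> = (\<integral>\<^sup>+w. ennreal (indicator {0..} w * w powr (\<alpha> * real m - 1) * exp (- (w powr \<alpha>))) \<partial>lborel)"
    proof (rule nn_integral_cong)
      fix w :: real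
      show "(\<integral>\<^sup>+\<omega>. ennreal (indicator {0..} w * w powr (a - 1) * exp (- w * H 1 \<omega>)) \<partial>M) =
          ennreal (indicator {0..} w * w powr (\<alpha> * real m - 1) * exp (- (w powr \<alpha>)))"
      proof (cases "0 < w")
        case True
        have "(\<integral>\<^sup>+\<omega>. ennreal (exp (- w * H 1 \<omega>)) \<partial>M) = ennreal (exp (- (w powr \<alpha>)))"
          using stable_subordinator_integrable[OF H, of 1 w] stable_subordinator_laplace[OF H, of 1 w] True
          by (subst nn_integral_eq_integral) auto
        then show ?thesis
          using True by (simp add: a_def ennreal_mult' nn_integral_cmult)
      next
        case False
        then show ?thesis by (cases "w = 0") (auto simp: indicator_def)
      qed
    qed
    also have "\<dots> = ennreal (fact (m - 1) / \<alpha>)"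
      using False \<alpha> by (intro nn_integral_powr_exp_powr) auto
    finally have "(\<integral>\<^sup>+\<omega>. ennreal (Gamma a * (H 1 \<omega> powr (- \<alpha>)) ^ m) \<partial>M) = ennreal (fact (m - 1) / \<alpha>)" .
    then have I: "integrable M (\<lambda>\<omega>. Gamma a * (H 1 \<omega> powr (- \<alpha>)) ^ m)"
      and E: "expectation (\<lambda>\<omega>. Gamma a * (H 1 \<omega> powr (- \<alpha>)) ^ m) = fact (m - 1) / \<alpha>"
      using \<alpha> Ga by (subst (asm) nn_integral_eq_integrable; auto)+
    have "Gamma (a + 1) = a * Gamma a"
      using a nonpos_Ints_nonpos[of a] by (intro Gamma_plus1) auto
    moreover have "fact m = real m * fact (m - 1)" using False by (simp add: fact_reduce)
    ultimately have "fact (m - 1) / \<alpha> / Gamma a = fact m / Gamma (\<alpha> * real m + 1)"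
      using \<alpha> False by (simp add: a_def)
    moreover have "expectation (\<lambda>\<omega>. (H 1 \<omega> powr (- \<alpha>)) ^ m) = fact (m - 1) / \<alpha> / Gamma a"
    proof -
      have "Gamma a * expectation (\<lambda>\<omega>. (H 1 \<omega> powr (- \<alpha>)) ^ m) = fact (m - 1) / \<alpha>"
        using E by simp
      then show ?thesis using Ga by (metis less_irrefl nonzero_mult_div_cancel_left)
    qed
    ultimately show ?thesis
      using I Ga by simp
  qed
  then show "integrable M (\<lambda>\<omega>. (H 1 \<omega> powr (- \<alpha>)) ^ m)"
    "expectation (\<lambda>\<omega>. (H 1 \<omega> powr (- \<alpha>)) ^ m) = fact m / Gamma (\<alpha> * real m + 1)" by auto
qed

section \<open>The law of the inverse subordinator\<close>

lemma inverse_process_le: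
  assumes "0 < x" "s < H x \<omega>"
  shows "inverse_process H s \<omega> \<le> x"
  unfolding inverse_process_def
  by (rule cInf_lower) (use assms in \<open>auto intro!: bdd_belowI[of _ 0]\<close>)

text \<open>
  Only almost surely, since on paths that never exceed \<open>s\<close> the infimum is that of the empty set.
\<close>

lemma inverse_process_nonneg:
  assumes "stable_subordinator \<alpha> H"
  shows "AE \<omega> in M. 0 \<le> inverse_process H s \<omega>"
  using stable_subordinator_unbounded[OF assms, of s]
proof eventually_elim
  case (elim \<omega>)
  then obtain n :: nat where "s < H (real n + 1) \<omega>" by blast
  then have "{\<tau>. 0 < \<tau> \<and> s < H \<tau> \<omega>} \<noteq> {}"
    by (auto intro!: exI[of _ "real n + 1"])
  then show ?case
    unfolding inverse_process_def by (rule cInf_greatest) auto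
qed

lemma less_subordinator_if_inverse_process_less:
  assumes "stable_subordinator \<alpha> H"
  shows "AE \<omega> in M. \<forall>y>0. inverse_process H s \<omega> < y \<longrightarrow> s < H y \<omega>"
  using stable_subordinator_unbounded[OF assms, of s] AE_space
proof eventually_elim
  case (elim \<omega>)
  then obtain n :: nat where "s < H (real n + 1) \<omega>" by blast
  then have ne: "{\<tau>. 0 < \<tau> \<and> s < H \<tau> \<omega>} \<noteq> {}"
    by (auto intro!: exI[of _ "real n + 1"])
  show ?case
  proof (intro allI impI)
    fix y :: real assume "0 < y" "inverse_process H s \<omega> < y"
    then obtain \<tau> where "0 < \<tau>" "s < H \<tau> \<omega>" "\<tau> < y"
      using cInf_lessD[OF ne] unfolding inverse_process_def by blast
    then show "s < H y \<omega>"
      using stable_subordinator_mono[OF assms, of \<omega> \<tau> y] elim by simp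
  qed
qed

text \<open>
  For \<open>s > 0\<close>, self-similarity gives \<open>P(H(x) > s) = P(Z < x)\<close> for \<open>Z = s\<^sup>\<alpha> H(1)\<^bsup>-\<alpha>\<^esup>\<close>. The event
  \<open>H(x) > s\<close> lies between \<open>E(s) < x\<close> and \<open>E(s) \<le> x\<close>, which is enough to interlace the two distribution
  functions. For \<open>s = 0\<close> both
  variables vanish almost surely.
\<close>

lemma distr_inverse_process:
  assumes H: "stable_subordinator \<alpha> H" and \<alpha>: "0 < \<alpha>" and s: "0 \<le> s"
    and [measurable]: "random_variable borel (inverse_process H s)"
  shows "distr M borel (inverse_process H s) = distr M borel (\<lambda>\<omega>. s powr \<alpha> * H 1 \<omega> powr (- \<alpha>))"
    (is "_ = distr M borel ?Z")
proof (cases "s = 0")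
  case True
  have "AE \<omega> in M. \<forall>n::nat. 0 < H (1 / (real n + 1)) \<omega>"
    unfolding AE_all_countable using stable_subordinator_pos[OF H \<alpha>] by simp
  then have "AE \<omega> in M. inverse_process H s \<omega> = ?Z \<omega>"
    using inverse_process_nonneg[OF H, of s]
  proof eventually_elim
    case (elim \<omega>)
    have "inverse_process H s \<omega> \<le> 1 / (real n + 1)" for n
      using elim True by (intro inverse_process_le) auto
    moreover have "(\<lambda>n. 1 / (real n + 1)) \<longlonglongrightarrow> 0" by real_asymp
    ultimately have "inverse_process H s \<omega> \<le> 0"
      by (intro LIMSEQ_le_const) auto
    then show ?case using elim True by simp
  qed
  moreover have [measurable]: "random_variable borel (H 1)"
    using H stable_subordinator_measurable by simp
  ultimately show ?thesis by (intro distr_cong_AE) auto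
next
  case False
  with s have s: "0 < s" by simp
  have [measurable]: "random_variable borel (H x)" if "0 < x" for x
    using H that stable_subordinator_measurable by simp
  let ?E = "inverse_process H s"
  have key: "prob {\<omega> \<in> space M. s < H x \<omega>} = prob {\<omega> \<in> space M. ?Z \<omega> < x}" if x: "0 < x" for x
  proof -
    have "prob {\<omega> \<in> space M. s < H x \<omega>} = measure (distr M borel (H x)) {s<..}"
      using x by (subst measure_distr) (auto intro!: arg_cong[where f=prob])
    also have "\<dots> = measure (distr M borel (\<lambda>\<omega>. x powr (1 / \<alpha>) * H 1 \<omega>)) {s<..}"
      using stable_subordinator_self_similar[OF H \<alpha> x] by simp
    also have "\<dots> = prob {\<omega> \<in> space M. s < x powr (1 / \<alpha>) * H 1 \<omega>}"
      by (subst measure_distr) (auto intro!: arg_cong[where f=prob])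
    also have "\<dots> = prob {\<omega> \<in> space M. ?Z \<omega> < x}"
    proof (rule finite_measure_eq_AE)
      show "AE \<omega> in M. \<omega> \<in> {\<omega> \<in> space M. s < x powr (1 / \<alpha>) * H 1 \<omega>} \<longleftrightarrow> \<omega> \<in> {\<omega> \<in> space M. ?Z \<omega> < x}"
        using stable_subordinator_pos[OF H \<alpha> zero_less_one]
      proof eventually_elim
        case (elim \<omega>)
        let ?h = "H 1 \<omega>"
        have "s < x powr (1 / \<alpha>) * ?h \<longleftrightarrow> s powr \<alpha> < (x powr (1 / \<alpha>) * ?h) powr \<alpha>"
          using s x \<alpha> elim
          by (metis less_imp_le powr_less_mono2 powr_mono2 linorder_not_le mult_nonneg_nonneg powr_ge_zero)
        also have "(x powr (1 / \<alpha>) * ?h) powr \<alpha> = x * ?h powr \<alpha>"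
          using x \<alpha> elim by (simp add: powr_mult powr_powr)
        also have "s powr \<alpha> < x * ?h powr \<alpha> \<longleftrightarrow> ?Z \<omega> < x"
          using elim by (simp add: powr_minus field_simps)
        finally show ?case by simp
      qed
    qed auto
    finally show ?thesis .
  qed
  have cdfE: "cdf (distr M borel ?E) x = prob {\<omega> \<in> space M. ?E \<omega> \<le> x}" for x
    by (subst cdf_def2, subst measure_distr) (auto intro!: arg_cong[where f=prob])
  have cdfZ: "cdf (distr M borel ?Z) x = prob {\<omega> \<in> space M. ?Z \<omega> \<le> x}" for x
    by (subst cdf_def2, subst measure_distr) (auto intro!: arg_cong[where f=prob])
  show ?thesis
  proof (rule real_distribution_eqI_cdf)
    show "real_distribution (distr M borel ?E)" "real_distribution (distr M borel ?Z)"
      by (intro real_distribution_distr, measurable)+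
    fix x y :: real assume xy: "x < y"
    show "cdf (distr M borel ?E) x \<le> cdf (distr M borel ?Z) y"
    proof (cases "0 < y")
      case True
      have "prob {\<omega> \<in> space M. ?E \<omega> \<le> x} \<le> prob {\<omega> \<in> space M. s < H y \<omega>}"
      proof (rule finite_measure_mono_AE)
        show "AE \<omega> in M. \<omega> \<in> {\<omega> \<in> space M. ?E \<omega> \<le> x} \<longrightarrow> \<omega> \<in> {\<omega> \<in> space M. s < H y \<omega>}"
          using less_subordinator_if_inverse_process_less[OF H, of s]
          by eventually_elim (use True xy in auto)
      qed (use True in measurable)
      also have "\<dots> = prob {\<omega> \<in> space M. ?Z \<omega> < y}" by (rule key[OF True])
      also have "\<dots> \<le> prob {\<omega> \<in> space M. ?Z \<omega> \<le> y}"
        by (rule finite_measure_mono) auto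
      finally show ?thesis unfolding cdfE cdfZ .
    next
      case False
      then have "x < 0" using xy by simp
      then have "prob {\<omega> \<in> space M. ?E \<omega> \<le> x} = 0"
        by (subst prob_eq_0) (use inverse_process_nonneg[OF H, of s] in \<open>auto elim: eventually_mono\<close>)
      then show ?thesis unfolding cdfE cdfZ by simp
    qed
    show "cdf (distr M borel ?Z) x \<le> cdf (distr M borel ?E) y"
    proof (cases "0 < y")
      case True
      have "prob {\<omega> \<in> space M. ?Z \<omega> \<le> x} \<le> prob {\<omega> \<in> space M. ?Z \<omega> < y}"
        by (rule finite_measure_mono) (use xy in auto)
      also have "\<dots> = prob {\<omega> \<in> space M. s < H y \<omega>}" by (rule key[OF True, symmetric])
      also have "\<dots> \<le> prob {\<omega> \<in> space M. ?E \<omega> \<le> y}"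
        by (rule finite_measure_mono) (use True in \<open>auto intro: inverse_process_le\<close>)
      finally show ?thesis unfolding cdfE cdfZ .
    next
      case False
      have "0 \<le> ?Z \<omega>" for \<omega> by simp
      moreover have "x < 0" using False xy by simp
      ultimately have "{\<omega> \<in> space M. ?Z \<omega> \<le> x} = {}" by (auto simp: not_le intro: less_le_trans)
      then show ?thesis unfolding cdfE cdfZ by (simp only: measure_empty measure_nonneg)
    qed
  qed
qed

section \<open>A random field evaluated at an independent time\<close>

lemma prob_at_independent_index:
  fixes K :: "'a \<Rightarrow> nat" and A :: "nat \<Rightarrow> 'a set"
  assumes [measurable]: "K \<in> measurable M (count_space UNIV)" "\<And>i. A i \<in> events"
    and indep: "\<And>i. prob ({\<omega> \<in> space M. K \<omega> = i} \<inter> A i) = prob {\<omega> \<in> space M. K \<omega> = i} * prob (A i)"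
  shows "{\<omega> \<in> space M. \<omega> \<in> A (K \<omega>)} \<in> events"
    and "prob {\<omega> \<in> space M. \<omega> \<in> A (K \<omega>)} = expectation (\<lambda>\<omega>. prob (A (K \<omega>)))"
proof -
  define B where "B i = {\<omega> \<in> space M. K \<omega> = i} \<inter> A i" for i
  have [measurable]: "B i \<in> events" for i unfolding B_def by measurable
  have U: "{\<omega> \<in> space M. \<omega> \<in> A (K \<omega>)} = (\<Union>i. B i)" by (auto simp: B_def)
  show "{\<omega> \<in> space M. \<omega> \<in> A (K \<omega>)} \<in> events" unfolding U by measurable
  have "disjoint_family B" by (auto simp: disjoint_family_on_def B_def)
  then have sB: "(\<lambda>i. prob (B i)) sums prob {\<omega> \<in> space M. \<omega> \<in> A (K \<omega>)}"
    unfolding U by (intro finite_measure_UNION) auto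
  define f where "f i \<omega> = prob (A i) * indicator {\<omega> \<in> space M. K \<omega> = i} \<omega>" for i \<omega>
  have f_single: "f i \<omega> = 0" if "i \<noteq> K \<omega>" for i \<omega>
    using that by (simp add: f_def indicator_def)
  have int: "integrable M (f i)" for i
    unfolding f_def by (intro integrable_mult_right integrable_real_indicator) (auto simp: emeasure_eq_measure)
  have val: "expectation (f i) = prob (B i)" for i
    unfolding f_def B_def indep by simp
  have "(\<lambda>i. expectation (f i)) sums expectation (\<lambda>\<omega>. \<Sum>i. f i \<omega>)"
  proof (rule sums_integral[OF int])
    show "AE \<omega> in M. summable (\<lambda>i. norm (f i \<omega>))"
    proof (rule AE_I2)
      show "summable (\<lambda>i. norm (f i \<omega>))" for \<omega>
        by (rule summable_finite[of "{K \<omega>}"]) (auto simp: f_single)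
    qed
    have "norm (f i \<omega>) = f i \<omega>" for i \<omega> by (simp add: f_def)
    then show "summable (\<lambda>i. expectation (\<lambda>\<omega>. norm (f i \<omega>)))"
      using sB by (simp add: val sums_iff)
  qed
  also have "expectation (\<lambda>\<omega>. \<Sum>i. f i \<omega>) = expectation (\<lambda>\<omega>. prob (A (K \<omega>)))"
  proof (rule Bochner_Integration.integral_cong[OF refl])
    fix \<omega> assume "\<omega> \<in> space M"
    moreover have "(\<Sum>i. f i \<omega>) = (\<Sum>i\<in>{K \<omega>}. f i \<omega>)"
      by (rule suminf_finite) (auto simp: f_single)
    ultimately show "(\<Sum>i. f i \<omega>) = prob (A (K \<omega>))" by (simp add: f_def)
  qed
  finally show "prob {\<omega> \<in> space M. \<omega> \<in> A (K \<omega>)} = expectation (\<lambda>\<omega>. prob (A (K \<omega>)))"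
    using sB by (simp add: val sums_iff)
qed

text \<open>
  The time \<open>T\<close> is replaced by the grid point \<open>\<tau> j > T\<close> of mesh \<open>1 / (j + 1)\<close> next to it, which has countably
  many values, so that \<open>prob_at_independent_index\<close> applies. As \<open>j\<close> grows, \<open>\<tau> j\<close> tends to \<open>T\<close> from
  the right, and \<open>V\<close> is constant just to the right of \<open>T\<close>; hence the indicators converge, which gives
  the measurability of the limiting event as well as its probability.
\<close>

lemma prob_at_independent_time:
  fixes V :: "real \<Rightarrow> 'a \<Rightarrow> real" and T :: "'a \<Rightarrow> real"
  assumes [measurable]: "random_variable borel T" and T: "\<And>\<omega>. 0 \<le> T \<omega>"
    and V: "\<And>x. 0 \<le> x \<Longrightarrow> random_variable borel (V x)"
    and step: "\<And>\<omega> x. \<omega> \<in> space M \<Longrightarrow> 0 \<le> x \<Longrightarrow> \<forall>\<^sub>F y in at_right x. V y \<omega> = V x \<omega>"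
    and indep: "\<And>B x. B \<in> sets borel \<Longrightarrow> 0 \<le> x \<Longrightarrow>
      prob ({\<omega> \<in> space M. T \<omega> \<in> B} \<inter> {\<omega> \<in> space M. V x \<omega> = v}) =
      prob {\<omega> \<in> space M. T \<omega> \<in> B} * prob {\<omega> \<in> space M. V x \<omega> = v}"
    and \<phi>: "\<And>x. 0 \<le> x \<Longrightarrow> prob {\<omega> \<in> space M. V x \<omega> = v} = \<phi> x" "\<And>x. isCont \<phi> x"
  shows "{\<omega> \<in> space M. V (T \<omega>) \<omega> = v} \<in> events"
    and "prob {\<omega> \<in> space M. V (T \<omega>) \<omega> = v} = expectation (\<lambda>\<omega>. \<phi> (T \<omega>))"
proof -
  define grid where "grid j i = (real i + 1) / (real j + 1)" for j i :: nat
  define K where "K j \<omega> = nat \<lfloor>(real j + 1) * T \<omega>\<rfloor>" for j :: nat and \<omega>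
  define \<tau> where "\<tau> j \<omega> = grid j (K j \<omega>)" for j \<omega>
  have grid_pos: "0 \<le> grid j i" for i j by (simp add: grid_def)
  have [measurable]: "K j \<in> measurable M (count_space UNIV)" for j
    unfolding K_def by measurable
  have \<tau>_gt: "T \<omega> < \<tau> j \<omega>" and \<tau>_le: "\<tau> j \<omega> \<le> T \<omega> + 1 / (real j + 1)" for j \<omega>
  proof -
    have "real (K j \<omega>) = of_int \<lfloor>(real j + 1) * T \<omega>\<rfloor>" using T[of \<omega>] by (simp add: K_def)
    then have "(real j + 1) * T \<omega> < real (K j \<omega>) + 1" "real (K j \<omega>) \<le> (real j + 1) * T \<omega>"
      by linarith+
    then have "T \<omega> < (real (K j \<omega>) + 1) / (real j + 1)" "real (K j \<omega>) / (real j + 1) \<le> T \<omega>"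
      by (simp_all add: less_divide_eq divide_le_eq mult.commute)
    then show "T \<omega> < \<tau> j \<omega>" "\<tau> j \<omega> \<le> T \<omega> + 1 / (real j + 1)"
      by (simp_all add: \<tau>_def grid_def add_divide_distrib)
  qed
  have \<tau>_lim: "(\<lambda>j. \<tau> j \<omega>) \<longlonglongrightarrow> T \<omega>" for \<omega>
  proof (rule tendsto_sandwich[where f="\<lambda>_. T \<omega>" and h="\<lambda>j. T \<omega> + 1 / (real j + 1)"])
    show "(\<lambda>j. T \<omega> + 1 / (real j + 1)) \<longlonglongrightarrow> T \<omega>" by real_asymp
    show "\<forall>\<^sub>F j in sequentially. T \<omega> \<le> \<tau> j \<omega>"
      by (intro always_eventually allI less_imp_le \<tau>_gt)
    show "\<forall>\<^sub>F j in sequentially. \<tau> j \<omega> \<le> T \<omega> + 1 / (real j + 1)"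
      by (intro always_eventually allI \<tau>_le)
  qed (rule tendsto_const)
  have ev: "\<forall>\<^sub>F j in sequentially. V (\<tau> j \<omega>) \<omega> = V (T \<omega>) \<omega>" if "\<omega> \<in> space M" for \<omega>
  proof -
    have "filterlim (\<lambda>j. \<tau> j \<omega>) (at_right (T \<omega>)) sequentially"
      unfolding filterlim_at using \<tau>_lim[of \<omega>] \<tau>_gt[of \<omega>] by (auto simp: less_imp_neq[symmetric])
    then show ?thesis
      using step[OF that T] by (rule eventually_compose_filterlim[rotated])
  qed
  define A where "A j = {\<omega> \<in> space M. V (\<tau> j \<omega>) \<omega> = v}" for j
  define A0 where "A0 = {\<omega> \<in> space M. V (T \<omega>) \<omega> = v}"
  have [measurable]: "{\<omega> \<in> space M. V (grid j i) \<omega> = v} \<in> events" for i j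
    using V[OF grid_pos] by measurable
  have A_eq: "A j = {\<omega> \<in> space M. \<omega> \<in> {\<omega> \<in> space M. V (grid j (K j \<omega>)) \<omega> = v}}" for j
    by (auto simp: A_def \<tau>_def)
  have ind: "prob ({\<omega> \<in> space M. K j \<omega> = i} \<inter> {\<omega> \<in> space M. V (grid j i) \<omega> = v}) =
      prob {\<omega> \<in> space M. K j \<omega> = i} * prob {\<omega> \<in> space M. V (grid j i) \<omega> = v}" for i j
  proof -
    have "(\<lambda>x. nat \<lfloor>(real j + 1) * x\<rfloor>) -` {i} \<inter> space borel \<in> sets (borel :: real measure)"
      by (rule measurable_sets[where A="count_space UNIV"]) auto
    from indep[OF this grid_pos, of j i] show ?thesis by (simp add: K_def)
  qed
  have [measurable]: "A j \<in> events" and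
    prA: "prob (A j) = expectation (\<lambda>\<omega>. \<phi> (\<tau> j \<omega>))" for j
    using prob_at_independent_index[of "K j" "\<lambda>i. {\<omega> \<in> space M. V (grid j i) \<omega> = v}", OF _ _ ind]
    by (simp_all add: A_def \<tau>_def \<phi>(1)[OF grid_pos] cong: conj_cong)
  have lim: "(\<lambda>j. indicator (A j) \<omega> :: real) \<longlonglongrightarrow> indicator A0 \<omega>" if "\<omega> \<in> space M" for \<omega>
    using ev[OF that] by (intro tendsto_eventually) (auto simp: A_def A0_def indicator_def elim!: eventually_mono)
  have "(indicator A0 :: 'a \<Rightarrow> real) \<in> borel_measurable M"
    by (rule borel_measurable_LIMSEQ_real[OF lim]) auto
  then have "A0 \<inter> space M \<in> events" by (simp add: borel_measurable_indicator_iff)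
  then show [measurable]: "{\<omega> \<in> space M. V (T \<omega>) \<omega> = v} \<in> events"
    by (simp add: A0_def Int_def conj_commute cong: conj_cong)
  then have [measurable]: "A0 \<in> events" by (simp add: A0_def)
  have "(\<lambda>j. expectation (indicat_real (A j))) \<longlonglongrightarrow> expectation (indicat_real A0)"
    by (rule integral_dominated_convergence[where w="\<lambda>_. 1"]) (use lim in \<open>auto simp: indicator_def\<close>)
  moreover have "(\<lambda>j. expectation (\<lambda>\<omega>. \<phi> (\<tau> j \<omega>))) \<longlonglongrightarrow> expectation (\<lambda>\<omega>. \<phi> (T \<omega>))"
  proof (rule integral_dominated_convergence[where w="\<lambda>_. 1"])
    have l: "(\<lambda>j. \<phi> (\<tau> j \<omega>)) \<longlonglongrightarrow> \<phi> (T \<omega>)" for \<omega>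
      using \<phi>(2) \<tau>_lim by (rule isCont_tendsto_compose)
    then show "AE \<omega> in M. (\<lambda>j. \<phi> (\<tau> j \<omega>)) \<longlonglongrightarrow> \<phi> (T \<omega>)" by simp
    show m: "(\<lambda>\<omega>. \<phi> (\<tau> j \<omega>)) \<in> borel_measurable M" for j
      unfolding \<tau>_def by measurable
    show "(\<lambda>\<omega>. \<phi> (T \<omega>)) \<in> borel_measurable M"
      by (rule borel_measurable_LIMSEQ_real[OF l m])
    show "AE \<omega> in M. norm (\<phi> (\<tau> j \<omega>)) \<le> 1" for j
      by (simp add: \<tau>_def \<phi>(1)[OF grid_pos, symmetric])
  qed simp
  ultimately show "prob {\<omega> \<in> space M. V (T \<omega>) \<omega> = v} = expectation (\<lambda>\<omega>. \<phi> (T \<omega>))"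
    using LIMSEQ_unique by (simp add: prA A0_def)
qed

end

section \<open>Counts in rectangles and the Skellam field\<close>

lemma rect_in_borel_quadrant: "{0..x} \<times> {0..t} \<in> sets borel_quadrant"
proof -
  have "closed quadrant" unfolding quadrant_def by (intro closed_Times closed_atLeast)
  then have "quadrant \<in> sets borel" by (rule borel_closed)
  moreover have "{0..x} \<times> {0..t} \<in> sets (borel :: (real \<times> real) measure)"
    by (intro borel_closed closed_Times closed_atLeastAtMost)
  ultimately show ?thesis
    by (subst sets_restrict_space_iff) (auto simp: quadrant_def)
qed

lemma bounded_rect: "bounded ({0..x} \<times> {0..t :: real} :: (real \<times> real) set)"
  by (intro bounded_Times bounded_closed_interval)

lemma lborel_rect:
  assumes "0 \<le> x" "0 \<le> t"
  shows "emeasure lborel ({0..x} \<times> {0..t :: real}) = ennreal (x * t)"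
    and "measure lborel ({0..x} \<times> {0..t :: real}) = x * t"
proof -
  have "emeasure (lborel \<Otimes>\<^sub>M lborel) ({0..x} \<times> {0..t :: real}) = ennreal x * ennreal t"
    using assms by (subst lborel.emeasure_pair_measure_Times) auto
  then show E: "emeasure lborel ({0..x} \<times> {0..t :: real}) = ennreal (x * t)"
    using assms by (simp add: lborel_prod ennreal_mult)
  show "measure lborel ({0..x} \<times> {0..t :: real}) = x * t"
    unfolding measure_def E using assms by simp
qed

context prob_space
begin

lemma vimage_in_generated_sigma:
  assumes "i \<in> I" "A \<in> sets borel"
  shows "X i -` A \<inter> space M \<in> generated_sigma I X"
  unfolding generated_sigma_def
proof (rule sigma_sets.Basic, rule UN_I[OF assms(1)])
  show "X i -` A \<inter> space M \<in> {X i -` A \<inter> space M |A. A \<in> sets borel}"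
    using assms(2) by auto
qed

lemma poisson_random_field_rect:
  assumes "poisson_random_field l N" "\<omega> \<in> space M"
  shows "\<exists>k::nat. emeasure (N \<omega>) ({0..x} \<times> {0..t}) = of_nat k \<and> rect_count N x t \<omega> = real k"
proof -
  let ?R = "{0..x} \<times> {0..t}"
  have "emeasure (N \<omega>) ?R \<in> range ennreal_of_enat" "emeasure (N \<omega>) ?R < \<infinity>"
    using assms rect_in_borel_quadrant[of x t] bounded_rect[of x t]
    unfolding poisson_random_field_def by blast+
  then obtain e where e: "emeasure (N \<omega>) ?R = ennreal_of_enat e" "ennreal_of_enat e < \<infinity>" by auto
  then obtain k where k: "emeasure (N \<omega>) ?R = of_nat k" by (cases e rule: enat.exhaust) auto
  then show ?thesis
    by (intro exI[of _ k]) (simp add: rect_count_def measure_def)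
qed

lemma rect_count_eq_iff:
  assumes "poisson_random_field l N" "\<omega> \<in> space M"
  shows "rect_count N x t \<omega> = real k \<longleftrightarrow> emeasure (N \<omega>) ({0..x} \<times> {0..t}) = of_nat k"
  using poisson_random_field_rect[OF assms, of x t] by (metis of_nat_eq_iff)

lemma rect_count_measurable:
  assumes "poisson_random_field l N"
  shows "random_variable borel (rect_count N x t)"
proof -
  have [measurable]: "random_variable borel (\<lambda>\<omega>. emeasure (N \<omega>) ({0..x} \<times> {0..t}))"
    using assms rect_in_borel_quadrant[of x t] unfolding poisson_random_field_def by blast
  show ?thesis unfolding rect_count_def measure_def by measurable
qed

lemma prob_rect_count:
  assumes "poisson_random_field l N" "0 \<le> x" "0 \<le> t"
  shows "prob {\<omega> \<in> space M. rect_count N x t \<omega> = real k} = (l * (x * t)) ^ k / fact k * exp (- (l * (x * t)))"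
proof -
  have "\<forall>B\<in>sets borel_quadrant. emeasure lborel B < \<infinity> \<longrightarrow>
        (\<forall>k::nat. prob {\<omega> \<in> space M. emeasure (N \<omega>) B = of_nat k} =
           (l * measure lborel B) ^ k / fact k * exp (- (l * measure lborel B)))"
    using assms(1) unfolding poisson_random_field_def by blast
  from bspec[OF this rect_in_borel_quadrant[of x t]]
  have "prob {\<omega> \<in> space M. emeasure (N \<omega>) ({0..x} \<times> {0..t}) = of_nat k} =
      (l * (x * t)) ^ k / fact k * exp (- (l * (x * t)))"
    by (simp add: lborel_rect[OF assms(2,3)])
  also have "{\<omega> \<in> space M. emeasure (N \<omega>) ({0..x} \<times> {0..t}) = of_nat k} =
      {\<omega> \<in> space M. rect_count N x t \<omega> = real k}"
    using rect_count_eq_iff[OF assms(1)] by blast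
  finally show ?thesis .
qed

text \<open>
  Continuity from above of the measure \<open>N \<omega>\<close> along rectangles that shrink to the given one; convergent
  sequences of integers are eventually constant, and monotonicity covers all nearby widths.
\<close>

lemma rect_count_right_constant:
  assumes N: "poisson_random_field l N" "\<omega> \<in> space M"
  shows "\<forall>\<^sub>F y in at_right x. rect_count N y t \<omega> = rect_count N x t \<omega>"
proof -
  let ?R = "\<lambda>y. {0..y} \<times> {0..t}"
  have sets: "?R y \<in> sets (N \<omega>)" for y
    using N rect_in_borel_quadrant[of y t] unfolding poisson_random_field_def by blast
  have fin: "emeasure (N \<omega>) (?R y) \<noteq> \<infinity>" for y
    using poisson_random_field_rect[OF N, of y t] by auto
  have mono: "rect_count N y t \<omega> \<le> rect_count N z t \<omega>" if "y \<le> z" for y z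
    unfolding rect_count_def using that sets[of z] sets[of y] fin[of z]
    by (intro measure_mono_fmeasurable) (auto simp: fmeasurable_def less_top)
  define u where "u j = x + 1 / (real j + 1)" for j :: nat
  have "(\<Inter>j. ?R (u j)) = ?R x"
  proof (intro equalityI subsetI)
    fix q assume "q \<in> (\<Inter>j. ?R (u j))"
    then have q: "fst q \<le> x + 1 / (real j + 1)" "0 \<le> fst q" "snd q \<in> {0..t}" for j
      by (auto simp: u_def)
    have "(\<lambda>j. x + 1 / (real j + 1)) \<longlonglongrightarrow> x" by real_asymp
    then have "fst q \<le> x" by (rule LIMSEQ_le_const) (use q in auto)
    then show "q \<in> ?R x" using q(2,3) by (auto simp: mem_Times_iff)
  next
    fix q assume q: "q \<in> ?R x"
    have "x \<le> u j" for j by (simp add: u_def)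
    then have "?R x \<subseteq> ?R (u j)" for j by (intro Sigma_mono) auto
    with q show "q \<in> (\<Inter>j. ?R (u j))" by blast
  qed
  moreover have "decseq (\<lambda>j. ?R (u j))"
  proof (rule decseq_SucI)
    show "?R (u (Suc j)) \<subseteq> ?R (u j)" for j
      by (intro Sigma_mono) (auto simp: u_def field_simps intro: order_trans)
  qed
  ultimately have "(\<lambda>j. rect_count N (u j) t \<omega>) \<longlonglongrightarrow> rect_count N x t \<omega>"
    using Lim_measure_decseq[of "\<lambda>j. ?R (u j)" "N \<omega>"] sets fin by (auto simp: rect_count_def)
  then have "\<forall>\<^sub>F j in sequentially. dist (rect_count N (u j) t \<omega>) (rect_count N x t \<omega>) < 1"
    by (rule tendstoD) simp
  then obtain j where j: "dist (rect_count N (u j) t \<omega>) (rect_count N x t \<omega>) < 1"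
    using eventually_happens by fastforce
  have eq: "rect_count N (u j) t \<omega> = rect_count N x t \<omega>"
    using j poisson_random_field_rect[OF N, of "u j" t] poisson_random_field_rect[OF N, of x t]
    by (auto simp: dist_real_def)
  have "x < u j" by (simp add: u_def)
  then have "\<forall>\<^sub>F y in at_right x. y < u j" by (rule eventually_at_right_real[THEN eventually_mono]) simp
  with eventually_at_right_less show ?thesis
  proof eventually_elim
    case (elim y)
    then show ?case using mono[of x y] mono[of y "u j"] eq by simp
  qed
qed

lemma indep_rect_counts:
  assumes "poisson_random_field l1 N1" "poisson_random_field l2 N2" "indep_random_measures N1 N2"
  shows "prob ({\<omega> \<in> space M. rect_count N1 x t \<omega> = real a} \<inter> {\<omega> \<in> space M. rect_count N2 x t \<omega> = real b}) =
    prob {\<omega> \<in> space M. rect_count N1 x t \<omega> = real a} * prob {\<omega> \<in> space M. rect_count N2 x t \<omega> = real b}"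
proof (rule indep_setD)
  show "indep_set (generated_sigma (sets borel_quadrant) (\<lambda>B \<omega>. emeasure (N1 \<omega>) B))
      (generated_sigma (sets borel_quadrant) (\<lambda>B \<omega>. emeasure (N2 \<omega>) B))"
    using assms(3) unfolding indep_random_measures_def indep_families_def .
  have gen: "{\<omega> \<in> space M. rect_count N x t \<omega> = real k} \<in>
      generated_sigma (sets borel_quadrant) (\<lambda>B \<omega>. emeasure (N \<omega>) B)"
    if "poisson_random_field l N" for l N k
  proof -
    have "{\<omega> \<in> space M. rect_count N x t \<omega> = real k} =
        (\<lambda>\<omega>. emeasure (N \<omega>) ({0..x} \<times> {0..t})) -` {of_nat k} \<inter> space M"
      using rect_count_eq_iff[OF that] by auto
    also have "\<dots> \<in> generated_sigma (sets borel_quadrant) (\<lambda>B \<omega>. emeasure (N \<omega>) B)"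
      by (rule vimage_in_generated_sigma[where X="\<lambda>B \<omega>. emeasure (N \<omega>) B", OF rect_in_borel_quadrant]) simp
    finally show ?thesis .
  qed
  show "{\<omega> \<in> space M. rect_count N1 x t \<omega> = real a} \<in>
      generated_sigma (sets borel_quadrant) (\<lambda>B \<omega>. emeasure (N1 \<omega>) B)"
    using assms(1) by (rule gen)
  show "{\<omega> \<in> space M. rect_count N2 x t \<omega> = real b} \<in>
      generated_sigma (sets borel_quadrant) (\<lambda>B \<omega>. emeasure (N2 \<omega>) B)"
    using assms(2) by (rule gen)
qed

text \<open>
  Split according to the value \<open>b\<close> of the second count. When \<open>n + b < 0\<close> the event is empty and
  \<open>poisson_term\<close> is zero.
\<close>

lemma prob_skellam_field:
  assumes N: "poisson_random_field l1 N1" "poisson_random_field l2 N2" "indep_random_measures N1 N2"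
    and "0 \<le> x" "0 \<le> t"
  shows "prob {\<omega> \<in> space M. skellam_field N1 N2 x t \<omega> = real_of_int n} = skellam_pmf l1 l2 n (x * t)"
proof -
  have [measurable]: "random_variable borel (rect_count N1 x t)" "random_variable borel (rect_count N2 x t)"
    using N rect_count_measurable by blast+
  define B where "B b = {\<omega> \<in> space M. rect_count N1 x t \<omega> = real_of_int (n + int b)} \<inter>
      {\<omega> \<in> space M. rect_count N2 x t \<omega> = real b}" for b :: nat
  have "{\<omega> \<in> space M. skellam_field N1 N2 x t \<omega> = real_of_int n} = (\<Union>b. B b)"
  proof (intro equalityI subsetI)
    fix \<omega> assume "\<omega> \<in> {\<omega> \<in> space M. skellam_field N1 N2 x t \<omega> = real_of_int n}"
    then have \<omega>: "\<omega> \<in> space M" "rect_count N1 x t \<omega> - rect_count N2 x t \<omega> = real_of_int n"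
      by (auto simp: skellam_field_def)
    obtain b :: nat where "rect_count N2 x t \<omega> = real b"
      using poisson_random_field_rect[OF N(2) \<omega>(1)] by blast
    with \<omega> show "\<omega> \<in> (\<Union>b. B b)" by (auto simp: B_def intro!: exI[of _ b])
  qed (auto simp: B_def skellam_field_def)
  moreover have "disjoint_family B"
    by (auto simp: disjoint_family_on_def B_def)
  moreover have "range B \<subseteq> events"
    by (auto simp: B_def)
  ultimately have "(\<lambda>b. prob (B b)) sums prob {\<omega> \<in> space M. skellam_field N1 N2 x t \<omega> = real_of_int n}"
    using finite_measure_UNION[of B] by simp
  moreover have "prob (B b) = exp (- (l1 + l2) * (x * t)) *
      (poisson_term (n + int b) (l1 * (x * t)) * poisson_term (int b) (l2 * (x * t)))" for b
  proof (cases "n + int b < 0")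
    case True
    have "B b = {}"
    proof (rule ccontr)
      assume "B b \<noteq> {}"
      then obtain \<omega> where "\<omega> \<in> space M" "rect_count N1 x t \<omega> = real_of_int (n + int b)"
        by (auto simp: B_def)
      moreover have "0 \<le> rect_count N1 x t \<omega>" by (simp add: rect_count_def)
      ultimately show False using True by linarith
    qed
    then show ?thesis using True by (simp add: poisson_term_def)
  next
    case False
    define a where "a = nat (n + int b)"
    have a: "n + int b = int a" using False by (simp add: a_def)
    show ?thesis
      unfolding B_def a of_int_of_nat_eq indep_rect_counts[OF N] prob_rect_count[OF N(1) assms(4,5)]
        prob_rect_count[OF N(2) assms(4,5)]
      by (simp add: poisson_term_def exp_diff exp_minus field_simps exp_add)
  qed
  ultimately have "(\<lambda>b. exp (- (l1 + l2) * (x * t)) *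
      (poisson_term (n + int b) (l1 * (x * t)) * poisson_term (int b) (l2 * (x * t)))) sums
      prob {\<omega> \<in> space M. skellam_field N1 N2 x t \<omega> = real_of_int n}" by simp
  note S = this
  have "summable (\<lambda>b. poisson_term (n + int b) (l1 * (x * t)) * poisson_term (int b) (l2 * (x * t)))"
    using sums_summable[OF S] by (rule summable_mult_D) simp
  then have "(\<lambda>b. exp (- (l1 + l2) * (x * t)) *
      (poisson_term (n + int b) (l1 * (x * t)) * poisson_term (int b) (l2 * (x * t)))) sums
      skellam_pmf l1 l2 n (x * t)"
    unfolding skellam_pmf_def skellam_series_def by (intro sums_mult summable_sums)
  with S show ?thesis by (rule sums_unique2)
qed

lemma skellam_pmf_bounds:
  assumes N: "poisson_random_field l1 N1" "poisson_random_field l2 N2" "indep_random_measures N1 N2"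
    and "0 \<le> x"
  shows "0 \<le> skellam_pmf l1 l2 n x" "skellam_pmf l1 l2 n x \<le> 1"
proof -
  have "skellam_pmf l1 l2 n x = prob {\<omega> \<in> space M. skellam_field N1 N2 x 1 \<omega> = real_of_int n}"
    using prob_skellam_field[OF N assms(4), of 1 n] by simp
  then show "0 \<le> skellam_pmf l1 l2 n x" "skellam_pmf l1 l2 n x \<le> 1" by simp_all
qed

text \<open>
  The inverse subordinator is replaced by its positive part \<open>T\<close>, which agrees with it almost surely. Its
  exceptional negative values are harmless for measurability as well: there the rectangles are empty
  and the field is \<open>0\<close>.
\<close>

lemma prob_frac_skellam_field2:
  assumes N: "poisson_random_field l1 N1" "poisson_random_field l2 N2" "indep_random_measures N1 N2"
    and l: "0 \<le> l1" "0 \<le> l2"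
    and H: "stable_subordinator \<alpha> H" "0 < \<alpha>"
    and indep: "indep_field_process (skellam_field N1 N2) (inverse_process H)"
    and "0 \<le> s" "0 \<le> t"
  shows "prob {\<omega> \<in> space M. frac_skellam_field2 N1 N2 H s t \<omega> = real_of_int n} =
    expectation (\<lambda>\<omega>. skellam_pmf l1 l2 n (s powr \<alpha> * t * H 1 \<omega> powr (- \<alpha>)))"
proof -
  let ?E = "inverse_process H s" and ?V = "\<lambda>x. skellam_field N1 N2 x t"
  define T where "T \<omega> = max 0 (?E \<omega>)" for \<omega>
  define \<phi> where "\<phi> x = skellam_pmf l1 l2 n (x * t)" for x
  have iset: "indep_set (generated_sigma quadrant (\<lambda>(s, t). skellam_field N1 N2 s t))
      (generated_sigma {0..} (inverse_process H))"
    using indep unfolding indep_field_process_def indep_families_def .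
  have genE: "?E -` B \<inter> space M \<in> generated_sigma {0..} (inverse_process H)" if "B \<in> sets borel" for B
    using that \<open>0 \<le> s\<close> by (intro vimage_in_generated_sigma) auto
  have genV: "{\<omega> \<in> space M. ?V x \<omega> = v} \<in> generated_sigma quadrant (\<lambda>(s, t). skellam_field N1 N2 s t)"
    if "0 \<le> x" for x v
  proof -
    have "{\<omega> \<in> space M. ?V x \<omega> = v} = (case (x, t) of (s, t) \<Rightarrow> skellam_field N1 N2 s t) -` {v} \<inter> space M"
      by auto
    moreover have "(x, t) \<in> quadrant" using that \<open>0 \<le> t\<close> by (simp add: quadrant_def)
    ultimately show ?thesis
      using vimage_in_generated_sigma[of "(x, t)" quadrant "{v}" "\<lambda>(s, t). skellam_field N1 N2 s t"]
      by simp
  qed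
  have E[measurable]: "random_variable borel ?E"
  proof (rule measurableI)
    fix B :: "real set" assume "B \<in> sets borel"
    from genE[OF this] show "?E -` B \<inter> space M \<in> events"
      using iset unfolding indep_set_def indep_sets_def by (auto simp: UNIV_bool)
  qed simp
  have Tm[measurable]: "random_variable borel T" unfolding T_def by measurable
  have V[measurable]: "random_variable borel (?V x)" for x
    unfolding skellam_field_def using rect_count_measurable[OF N(1)] rect_count_measurable[OF N(2)] by measurable
  have cont: "isCont (skellam_pmf l1 l2 n) x" for x
    using DERIV_skellam_pmf[OF l] by (rule DERIV_isCont)
  have step: "\<forall>\<^sub>F y in at_right x. ?V y \<omega> = ?V x \<omega>" if "\<omega> \<in> space M" for x \<omega>
    using rect_count_right_constant[OF N(1) that, of t x] rect_count_right_constant[OF N(2) that, of t x]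
    by eventually_elim (simp add: skellam_field_def)
  have ind: "prob ({\<omega> \<in> space M. T \<omega> \<in> B} \<inter> {\<omega> \<in> space M. ?V x \<omega> = real_of_int n}) =
      prob {\<omega> \<in> space M. T \<omega> \<in> B} * prob {\<omega> \<in> space M. ?V x \<omega> = real_of_int n}"
    if B: "B \<in> sets borel" and x: "0 \<le> x" for B x
  proof -
    have "(\<lambda>y. max 0 y :: real) -` B \<inter> space borel \<in> sets borel"
      using B by (intro measurable_sets[where A=borel]) auto
    from genE[OF this] have "{\<omega> \<in> space M. T \<omega> \<in> B} \<in> generated_sigma {0..} (inverse_process H)"
      by (simp add: T_def vimage_def Int_def conj_commute)
    from indep_setD[OF iset genV[OF x] this] show ?thesis by (simp add: Int_commute mult.commute)
  qed
  have cont\<phi>: "isCont \<phi> x" for x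
    unfolding \<phi>_def by (rule isCont_o2[OF _ cont]) (intro continuous_intros)
  have T0: "0 \<le> T \<omega>" for \<omega> by (simp add: T_def)
  have pr\<phi>: "prob {\<omega> \<in> space M. ?V x \<omega> = real_of_int n} = \<phi> x" if "0 \<le> x" for x
    unfolding \<phi>_def by (rule prob_skellam_field[OF N that \<open>0 \<le> t\<close>])
  note TV = prob_at_independent_time[where T=T and V="?V" and v="real_of_int n" and \<phi>=\<phi>,
      OF Tm T0 V step ind pr\<phi> cont\<phi>]
  have neg: "?V x \<omega> = 0" if "x < 0" for x \<omega>
    using that by (simp add: skellam_field_def rect_count_def)
  have "{\<omega> \<in> space M. frac_skellam_field2 N1 N2 H s t \<omega> = real_of_int n} =
      ({\<omega> \<in> space M. 0 \<le> ?E \<omega>} \<inter> {\<omega> \<in> space M. ?V (T \<omega>) \<omega> = real_of_int n}) \<union>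
      {\<omega> \<in> space M. ?E \<omega> < 0 \<and> n = 0}"
    by (auto simp: frac_skellam_field2_def T_def neg not_less max_def not_le)
  also have "\<dots> \<in> events" by (intro sets.Un sets.Int TV(1)) auto
  finally have ev: "{\<omega> \<in> space M. frac_skellam_field2 N1 N2 H s t \<omega> = real_of_int n} \<in> events" .
  have nonneg: "AE \<omega> in M. T \<omega> = ?E \<omega>"
    using inverse_process_nonneg[OF H(1), of s] by eventually_elim (simp add: T_def)
  have "prob {\<omega> \<in> space M. frac_skellam_field2 N1 N2 H s t \<omega> = real_of_int n} =
      prob {\<omega> \<in> space M. ?V (T \<omega>) \<omega> = real_of_int n}"
  proof (rule finite_measure_eq_AE)
    show "AE \<omega> in M. \<omega> \<in> {\<omega> \<in> space M. frac_skellam_field2 N1 N2 H s t \<omega> = real_of_int n} \<longleftrightarrow>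
        \<omega> \<in> {\<omega> \<in> space M. ?V (T \<omega>) \<omega> = real_of_int n}"
      using nonneg by eventually_elim (simp add: frac_skellam_field2_def)
  qed (use ev TV in auto)
  note eq = this
  have [measurable]: "\<phi> \<in> borel_measurable borel"
    unfolding \<phi>_def by (intro borel_measurable_continuous_onI continuous_at_imp_continuous_on ballI
      isCont_o2[OF _ cont]) (intro continuous_intros)
  have H1[measurable]: "random_variable borel (H 1)"
    using stable_subordinator_measurable[OF H(1)] by simp
  have "prob {\<omega> \<in> space M. ?V (T \<omega>) \<omega> = real_of_int n} = expectation (\<lambda>\<omega>. \<phi> (T \<omega>))"
    using TV by simp
  also have "expectation (\<lambda>\<omega>. \<phi> (T \<omega>)) = expectation (\<lambda>\<omega>. \<phi> (?E \<omega>))"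
    using nonneg by (intro integral_cong_AE) (auto elim: eventually_mono)
  also have "\<dots> = (\<integral>x. \<phi> x \<partial>distr M borel ?E)"
    by (intro integral_distr[symmetric]) auto
  also have "\<dots> = (\<integral>x. \<phi> x \<partial>distr M borel (\<lambda>\<omega>. s powr \<alpha> * H 1 \<omega> powr (- \<alpha>)))"
    using distr_inverse_process[OF H \<open>0 \<le> s\<close> E] by simp
  also have "\<dots> = expectation (\<lambda>\<omega>. \<phi> (s powr \<alpha> * H 1 \<omega> powr (- \<alpha>)))"
    by (intro integral_distr) auto
  finally show ?thesis
    unfolding eq by (simp add: \<phi>_def mult_ac)
qed

section \<open>Expectations that produce Mittag-Leffler functions\<close>

text \<open>
  Dominated termwise integration. The bound on the integrals of the absolute values is the convergence of
  \<open>\<Sum> K\<^sup>m x\<^sup>m / \<Gamma>(\<alpha>m + 1)\<close>, that is, \<open>Y\<close> has exponential moments of all orders.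
\<close>

lemma expectation_power_series:
  fixes Y :: "'a \<Rightarrow> real" and A :: "nat \<Rightarrow> real" and \<alpha> C K x :: real
  assumes \<alpha>: "0 < \<alpha>" and K: "0 \<le> K" "\<And>m. \<bar>A m\<bar> \<le> C * K ^ m" and x: "0 \<le> x"
    and Y: "\<And>\<omega>. 0 \<le> Y \<omega>" "\<And>m. integrable M (\<lambda>\<omega>. Y \<omega> ^ m)"
      "\<And>m. expectation (\<lambda>\<omega>. Y \<omega> ^ m) = fact m / Gamma (\<alpha> * real m + 1)"
    and f: "\<And>\<omega>. (\<lambda>m. A m / fact m * (x * Y \<omega>) ^ m) sums f \<omega>"
  shows "integrable M f"
    and "(\<lambda>m. A m / Gamma (\<alpha> * real m + 1) * x ^ m) sums expectation f"
proof -
  define h where "h m \<omega> = A m / fact m * x ^ m * Y \<omega> ^ m" for m \<omega>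
  have int: "integrable M (h m)" for m
    unfolding h_def by (intro integrable_mult_right Y)
  have val: "expectation (h m) = A m / Gamma (\<alpha> * real m + 1) * x ^ m" for m
    unfolding h_def by (simp add: Y(3))
  have nval: "expectation (\<lambda>\<omega>. norm (h m \<omega>)) = \<bar>A m\<bar> / Gamma (\<alpha> * real m + 1) * x ^ m" for m
  proof -
    have "norm (h m \<omega>) = \<bar>A m\<bar> / fact m * x ^ m * Y \<omega> ^ m" for \<omega>
      unfolding h_def using x Y(1)[of \<omega>] by (simp add: abs_mult power_abs)
    then show ?thesis by (simp add: Y(3))
  qed
  have nsum: "summable (\<lambda>m. norm (h m \<omega>))" for \<omega>
  proof (rule summable_comparison_test')
    show "summable (\<lambda>m. C * ((K * x * Y \<omega>) ^ m / fact m))"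
      using summable_exp[of "K * x * Y \<omega>"] by (intro summable_mult) (simp add: field_simps)
    fix m :: nat
    have "\<bar>A m\<bar> * ((x * Y \<omega>) ^ m / fact m) \<le> C * K ^ m * ((x * Y \<omega>) ^ m / fact m)"
      using x Y(1)[of \<omega>] by (intro mult_right_mono K) auto
    then show "norm (norm (h m \<omega>)) \<le> C * ((K * x * Y \<omega>) ^ m / fact m)"
      using x Y(1)[of \<omega>] by (simp add: h_def abs_mult power_mult_distrib power_abs mult_ac)
  qed
  have vsum: "summable (\<lambda>m. expectation (\<lambda>\<omega>. norm (h m \<omega>)))"
    unfolding nval using \<alpha> K by (intro summable_mult_power_div_Gamma[where C=C and K=K]) auto
  have f_eq: "f = (\<lambda>\<omega>. \<Sum>m. h m \<omega>)"
    using f by (auto simp: h_def sums_iff power_mult_distrib mult.assoc fun_eq_iff)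
  show "integrable M f"
    unfolding f_eq using int nsum vsum by (intro integrable_suminf AE_I2)
  show "(\<lambda>m. A m / Gamma (\<alpha> * real m + 1) * x ^ m) sums expectation f"
    unfolding f_eq val[symmetric] using int nsum vsum by (intro sums_integral AE_I2)
qed

text \<open>
  Expanding the exponential gives a power series with coefficients \<open>A m / m!\<close>, where \<open>A\<close> grows at most
  geometrically since \<open>m! / (m - N)!\<close> is \<open>N!\<close> times a binomial coefficient. Dividing by Gamma values
  instead of factorials and shifting the index by \<open>N\<close> yields the Mittag-Leffler series, with
  \<open>(N + r)! / N!\<close> as its Pochhammer symbol.
\<close>

lemma expectation_power_exp:
  fixes Y :: "'a \<Rightarrow> real" and \<alpha> c x :: real
  assumes \<alpha>: "0 < \<alpha>" and x: "0 \<le> x" and c: "0 \<le> c"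
    and Y: "\<And>\<omega>. 0 \<le> Y \<omega>" "\<And>m. integrable M (\<lambda>\<omega>. Y \<omega> ^ m)"
      "\<And>m. expectation (\<lambda>\<omega>. Y \<omega> ^ m) = fact m / Gamma (\<alpha> * real m + 1)"
  shows "integrable M (\<lambda>\<omega>. (x * Y \<omega>) ^ N * exp (- c * (x * Y \<omega>)))"
    and "expectation (\<lambda>\<omega>. (x * Y \<omega>) ^ N * exp (- c * (x * Y \<omega>))) =
      fact N * x ^ N * mittag_leffler3 \<alpha> (\<alpha> * real N + 1) (real N + 1) (- (c * x))"
proof -
  define A where "A m = (if m < N then 0 else (- c) ^ (m - N) * (fact m / fact (m - N)))" for m
  have bound: "\<bar>A m\<bar> \<le> fact N * (2 * (1 + c)) ^ m" for m
  proof (cases "m < N")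
    case False
    then have "fact m / fact (m - N) = fact N * real (m choose N)"
      by (simp add: binomial_fact)
    moreover have "real (m choose N) \<le> 2 ^ m"
      using binomial_le_pow2[of m N] by (metis of_nat_le_iff of_nat_numeral of_nat_power)
    moreover have "c ^ (m - N) \<le> (1 + c) ^ m"
    proof -
      have "c ^ (m - N) \<le> (1 + c) ^ (m - N)" using c by (intro power_mono) auto
      also have "\<dots> \<le> (1 + c) ^ m" using c by (intro power_increasing) auto
      finally show ?thesis .
    qed
    ultimately have "c ^ (m - N) * (fact N * real (m choose N)) \<le> (1 + c) ^ m * (fact N * 2 ^ m)"
      using c by (intro mult_mono) auto
    moreover have "(2 * (1 + c)) ^ m = (1 + c) ^ m * 2 ^ m"
      by (simp only: power_mult_distrib mult.commute)
    ultimately show ?thesis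
      using False c \<open>fact m / fact (m - N) = _\<close> by (simp add: A_def abs_mult power_abs mult_ac)
  qed (use c in \<open>simp add: A_def\<close>)
  have series: "(\<lambda>m. A m / fact m * z ^ m) sums (z ^ N * exp (- c * z))" for z :: real
  proof -
    have "(\<lambda>r. (- c * z) ^ r / fact r) sums exp (- c * z)"
      using exp_converges[of "- c * z"] by (simp add: field_simps)
    then have "(\<lambda>r. z ^ N * ((- c * z) ^ r / fact r)) sums (z ^ N * exp (- c * z))"
      by (rule sums_mult)
    also have "(\<lambda>r. z ^ N * ((- c * z) ^ r / fact r)) = (\<lambda>r. A (r + N) / fact (r + N) * z ^ (r + N))"
    proof
      fix r
      have "(- c * z) ^ r = (- c) ^ r * z ^ r" by (rule power_mult_distrib)
      then show "z ^ N * ((- c * z) ^ r / fact r) = A (r + N) / fact (r + N) * z ^ (r + N)"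
        by (simp only: A_def) (simp add: power_add)
    qed
    finally have "(\<lambda>m. A m / fact m * z ^ m) sums (z ^ N * exp (- c * z) + (\<Sum>m<N. A m / fact m * z ^ m))"
      by (subst (asm) sums_iff_shift)
    then show ?thesis by (simp add: A_def)
  qed
  note E = expectation_power_series[OF \<alpha> _ bound x Y series]
  show "integrable M (\<lambda>\<omega>. (x * Y \<omega>) ^ N * exp (- c * (x * Y \<omega>)))"
    using c by (intro E(1)) auto
  have "(\<lambda>m. A m / Gamma (\<alpha> * real m + 1) * x ^ m) sums
      expectation (\<lambda>\<omega>. (x * Y \<omega>) ^ N * exp (- c * (x * Y \<omega>)))"
    using c by (intro E(2)) auto
  from sums_split_initial_segment[OF this, of N]
  have "(\<lambda>r. A (r + N) / Gamma (\<alpha> * real (r + N) + 1) * x ^ (r + N)) sums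
      expectation (\<lambda>\<omega>. (x * Y \<omega>) ^ N * exp (- c * (x * Y \<omega>)))"
    by (simp add: A_def)
  also have "(\<lambda>r. A (r + N) / Gamma (\<alpha> * real (r + N) + 1) * x ^ (r + N)) =
      (\<lambda>r. fact N * x ^ N * (pochhammer (real N + 1) r * (- (c * x)) ^ r /
        (Gamma (\<alpha> * real r + (\<alpha> * real N + 1)) * fact r)))"
  proof
    fix r
    have "fact (r + N) = fact N * pochhammer (real N + 1) r"
      using pochhammer_product'[of "1 :: real" N r] by (simp add: pochhammer_fact add_ac)
    moreover have "(- (c * x)) ^ r = (- c) ^ r * x ^ r"
      by (simp flip: power_mult_distrib)
    ultimately show "A (r + N) / Gamma (\<alpha> * real (r + N) + 1) * x ^ (r + N) =
      fact N * x ^ N * (pochhammer (real N + 1) r * (- (c * x)) ^ r /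
        (Gamma (\<alpha> * real r + (\<alpha> * real N + 1)) * fact r))"
      by (simp add: A_def power_add algebra_simps)
  qed
  finally have S: "(\<lambda>r. fact N * x ^ N * (pochhammer (real N + 1) r * (- (c * x)) ^ r /
        (Gamma (\<alpha> * real r + (\<alpha> * real N + 1)) * fact r))) sums
      expectation (\<lambda>\<omega>. (x * Y \<omega>) ^ N * exp (- c * (x * Y \<omega>)))" .
  \<comment> \<open>The Mittag-Leffler series is recovered by dividing by \<open>fact N * x ^ N\<close>, which vanishes only in the
    first case.\<close>
  show "expectation (\<lambda>\<omega>. (x * Y \<omega>) ^ N * exp (- c * (x * Y \<omega>))) =
      fact N * x ^ N * mittag_leffler3 \<alpha> (\<alpha> * real N + 1) (real N + 1) (- (c * x))"
  proof (cases "x = 0 \<and> 0 < N")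
    case True
    then show ?thesis by simp
  next
    case False
    then have "fact N * x ^ N \<noteq> 0" by auto
    with sums_summable[OF S] have "summable (\<lambda>r. pochhammer (real N + 1) r * (- (c * x)) ^ r /
        (Gamma (\<alpha> * real r + (\<alpha> * real N + 1)) * fact r))"
      by (rule summable_mult_D)
    from suminf_mult[OF this, of "fact N * x ^ N"] S show ?thesis
      unfolding mittag_leffler3_def by (simp add: sums_iff)
  qed
qed

lemma sums_expectation_nonneg_bounded:
  fixes h :: "nat \<Rightarrow> 'a \<Rightarrow> real"
  assumes int: "\<And>k. integrable M (h k)" and nonneg: "\<And>k \<omega>. 0 \<le> h k \<omega>"
    and sums: "\<And>\<omega>. (\<lambda>k. h k \<omega>) sums f \<omega>" and bnd: "\<And>\<omega>. f \<omega> \<le> B"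
  shows "(\<lambda>k. expectation (h k)) sums expectation f"
proof -
  have f_eq: "f = (\<lambda>\<omega>. \<Sum>k. h k \<omega>)" using sums by (auto simp: sums_iff)
  have "summable (\<lambda>k. expectation (h k))"
  proof (rule summableI_nonneg_bounded)
    show "0 \<le> expectation (h k)" for k by (intro Bochner_Integration.integral_nonneg nonneg)
    fix n
    have "(\<Sum>k<n. expectation (h k)) = expectation (\<lambda>\<omega>. \<Sum>k<n. h k \<omega>)"
      by (intro Bochner_Integration.integral_sum[symmetric] int)
    also have "\<dots> \<le> expectation (\<lambda>\<omega>. B)"
    proof (intro integral_mono Bochner_Integration.integrable_sum int)
      fix \<omega>
      have "(\<Sum>k<n. h k \<omega>) \<le> f \<omega>"
        using sum_le_suminf[of "\<lambda>k. h k \<omega>" "{..<n}"] sums[of \<omega>] nonneg by (simp add: sums_iff)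
      then show "(\<Sum>k<n. h k \<omega>) \<le> B" using bnd[of \<omega>] by simp
    qed simp
    finally show "(\<Sum>k<n. expectation (h k)) \<le> B" by (simp add: prob_space)
  qed
  then show ?thesis
    unfolding f_eq using sums nonneg by (intro sums_integral int AE_I2) (auto simp: sums_iff)
qed

end

section \<open>The fractional Skellam random field of type two\<close>

lemma skellam_pmf_0_0: "skellam_pmf l1 l2 0 0 = 1"
proof -
  have "skellam_series l1 l2 0 0 = (\<Sum>b\<in>{0}. poisson_term (int b) 0 * poisson_term (int b) 0)"
    unfolding skellam_series_def
    by (subst suminf_finite[of "{0}"]) (auto simp: poisson_term_def)
  then show ?thesis by (simp add: skellam_pmf_def poisson_term_def)
qed

theorem theorem5p2:
  fixes M :: "'a measure"
    and N1 N2 :: "'a \<Rightarrow> (real \<times> real) measure"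
    and H :: "real \<Rightarrow> 'a \<Rightarrow> real"
    and \<alpha> l1 l2 :: real
    and p :: "int \<Rightarrow> real \<Rightarrow> real \<Rightarrow> real"
  assumes "prob_space M"
    and "0 < \<alpha>" and "\<alpha> < 1" and "0 < l1" and "0 < l2"
    and "prob_space.poisson_random_field M l1 N1"
    and "prob_space.poisson_random_field M l2 N2"
    and "prob_space.indep_random_measures M N1 N2"
    and "prob_space.stable_subordinator M \<alpha> H"
    and "prob_space.indep_field_process M (skellam_field N1 N2) (inverse_process H)"
    and p_def: "\<And>n s t. p n s t =
      measure M {\<omega> \<in> space M. frac_skellam_field2 N1 N2 H s t \<omega> = real_of_int n}"
  shows
    "(\<forall>n. \<forall>s\<ge>0. \<forall>t\<ge>0.
        let c = (\<lambda>k. fact (nat \<bar>n\<bar> + 2 * k) * (sqrt (l1 * l2) * s powr \<alpha> * t) ^ (nat \<bar>n\<bar> + 2 * k)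
              / (fact (nat \<bar>n\<bar> + k) * fact k)
              * mittag_leffler3 \<alpha> (\<alpha> * real (nat \<bar>n\<bar> + 2 * k) + 1) (real (nat \<bar>n\<bar> + 2 * k) + 1)
                  (- ((l1 + l2) * s powr \<alpha> * t)))
        in summable c \<and> p n s t = (l1 / l2) powr (real_of_int n / 2) * (\<Sum>k. c k))
     \<and> (\<forall>n. \<forall>s>0. \<forall>t\<ge>0.
        caputo_differentiable \<alpha> (\<lambda>u. p n u t) s \<and>
        caputo_deriv \<alpha> (\<lambda>u. p n u t) s =
          - (l1 + l2) * t * p n s t + l1 * t * p (n - 1) s t + l2 * t * p (n + 1) s t)
     \<and> (\<forall>t\<ge>0. p 0 0 t = 1)"
proof -
  interpret prob_space M by fact
  note N = assms(6-8) and H = assms(9) and \<alpha> = assms(2,3)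
  have l: "0 \<le> l1" "0 \<le> l2" using assms by auto
  define Y where "Y \<omega> = H 1 \<omega> powr (- \<alpha>)" for \<omega>
  have Y: "0 \<le> Y \<omega>" "integrable M (\<lambda>\<omega>. Y \<omega> ^ m)"
    "expectation (\<lambda>\<omega>. Y \<omega> ^ m) = fact m / Gamma (\<alpha> * real m + 1)" for \<omega> m
    using stable_subordinator_negative_moments[OF H \<alpha>(1)] by (simp_all add: Y_def)
  have rep: "p n s t = expectation (\<lambda>\<omega>. skellam_pmf l1 l2 n (s powr \<alpha> * t * Y \<omega>))"
    if "0 \<le> s" "0 \<le> t" for n s t
    unfolding p_def Y_def by (rule prob_frac_skellam_field2[OF N l H \<alpha>(1) assms(10) that])
  have bnd: "0 \<le> skellam_pmf l1 l2 n x" "skellam_pmf l1 l2 n x \<le> 1" if "0 \<le> x" for n x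
    using skellam_pmf_bounds[OF N that] by auto

  \<comment> \<open>Below, \<open>h k\<close> is the \<open>k\<close>-th term of the Skellam probability at the random argument \<open>z * Y\<close>.\<close>
  have distribution: "summable c \<and> p n s t = (l1 / l2) powr (real_of_int n / 2) * (\<Sum>k. c k)"
    if s: "0 \<le> s" and t: "0 \<le> t"
      and c: "c = (\<lambda>k. fact (nat \<bar>n\<bar> + 2 * k) * (sqrt (l1 * l2) * s powr \<alpha> * t) ^ (nat \<bar>n\<bar> + 2 * k)
              / (fact (nat \<bar>n\<bar> + k) * fact k)
              * mittag_leffler3 \<alpha> (\<alpha> * real (nat \<bar>n\<bar> + 2 * k) + 1) (real (nat \<bar>n\<bar> + 2 * k) + 1)
                  (- ((l1 + l2) * s powr \<alpha> * t)))" for n s t c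
  proof -
    define z where "z = s powr \<alpha> * t"
    define P where "P = (l1 / l2) powr (real_of_int n / 2)"
    define e where "e k = nat \<bar>n\<bar> + 2 * k" for k
    define b where "b k = P * (sqrt (l1 * l2) ^ e k / (fact (nat \<bar>n\<bar> + k) * fact k))" for k
    define h where "h k \<omega> = b k * ((z * Y \<omega>) ^ e k * exp (- (l1 + l2) * (z * Y \<omega>)))" for k \<omega>
    have z: "0 \<le> z" using t by (simp add: z_def)
    have b: "0 \<le> b k" for k using l by (simp add: b_def P_def)
    have P: "P \<noteq> 0" using assms by (simp add: P_def)
    have Eh: "integrable M (h k)"
      "expectation (h k) = b k * (fact (e k) * z ^ e k *
        mittag_leffler3 \<alpha> (\<alpha> * real (e k) + 1) (real (e k) + 1) (- ((l1 + l2) * z)))" for k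
      using expectation_power_exp[OF \<alpha>(1) z _ Y, of "l1 + l2" "e k"] l
      unfolding h_def[abs_def] by simp_all
    have "(\<lambda>k. expectation (h k)) sums expectation (\<lambda>\<omega>. skellam_pmf l1 l2 n (z * Y \<omega>))"
    proof (rule sums_expectation_nonneg_bounded[OF Eh(1)])
      show "0 \<le> h k \<omega>" for k \<omega> using b z Y(1) by (simp add: h_def)
      show "skellam_pmf l1 l2 n (z * Y \<omega>) \<le> 1" for \<omega> using bnd z Y(1) by simp
      fix \<omega>
      have "(\<lambda>k. exp (- (l1 + l2) * (z * Y \<omega>)) * (P * ((sqrt (l1 * l2) * (z * Y \<omega>)) ^ e k /
          (fact (nat \<bar>n\<bar> + k) * fact k)))) sums skellam_pmf l1 l2 n (z * Y \<omega>)"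
        unfolding skellam_pmf_def P_def e_def
        by (intro sums_mult skellam_series_closed_form assms)
      also have "(\<lambda>k. exp (- (l1 + l2) * (z * Y \<omega>)) * (P * ((sqrt (l1 * l2) * (z * Y \<omega>)) ^ e k /
          (fact (nat \<bar>n\<bar> + k) * fact k)))) = (\<lambda>k. h k \<omega>)"
        unfolding h_def b_def power_mult_distrib[of "sqrt (l1 * l2)"] by (simp add: mult_ac)
      finally show "(\<lambda>k. h k \<omega>) sums skellam_pmf l1 l2 n (z * Y \<omega>)" .
    qed
    also have "(\<lambda>k. expectation (h k)) = (\<lambda>k. P * c k)"
    proof
      fix k
      have "(sqrt (l1 * l2) * s powr \<alpha> * t) ^ e k = sqrt (l1 * l2) ^ e k * z ^ e k"
        by (simp only: z_def mult.assoc flip: power_mult_distrib)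
      then show "expectation (h k) = P * c k"
        unfolding Eh(2) c b_def e_def[symmetric] by (simp only: z_def) (simp add: mult_ac)
    qed
    also have "expectation (\<lambda>\<omega>. skellam_pmf l1 l2 n (z * Y \<omega>)) = p n s t"
      unfolding z_def by (rule rep[OF s t, symmetric])
    finally have S: "(\<lambda>k. P * c k) sums p n s t" .
    have "summable c" using sums_summable[OF S] P by (rule summable_mult_D)
    then show ?thesis
      using S suminf_mult[of c P] by (simp add: sums_iff P_def)
  qed

  \<comment> \<open>The Taylor coefficients of the Skellam probabilities at \<open>0\<close>, without the factorials. The recursion
    \<open>A_Suc\<close> is the forward equation and becomes the fractional equation after the index shift.\<close>
  define A where "A n m = (skellam_generator l1 l2 ^^ m) (\<lambda>k. skellam_pmf l1 l2 k 0) n" for n m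
  have A_bound: "\<bar>A n m\<bar> \<le> (2 * (l1 + l2)) ^ m" for n m
    unfolding A_def using l bnd[of 0] by (intro abs_skellam_generator_funpow_le) auto
  have A_Suc: "A n (Suc m) = - (l1 + l2) * A n m + l1 * A (n - 1) m + l2 * A (n + 1) m" for n m
    by (simp add: A_def skellam_generator_def[of l1 l2 "(skellam_generator l1 l2 ^^ m) _"])
  have p_series: "(\<lambda>m. A n m / Gamma (\<alpha> * real m + 1) * (s powr \<alpha> * t) ^ m) sums p n s t"
    if s: "0 \<le> s" and t: "0 \<le> t" for n s t
    unfolding rep[OF that]
  proof (rule expectation_power_series(2)[OF \<alpha>(1), where C=1 and Y=Y])
    show "\<bar>A n m\<bar> \<le> 1 * (2 * (l1 + l2)) ^ m" for m using A_bound by simp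
    show "(\<lambda>m. A n m / fact m * (s powr \<alpha> * t * Y \<omega>) ^ m) sums
        skellam_pmf l1 l2 n (s powr \<alpha> * t * Y \<omega>)" for \<omega>
      unfolding A_def using bnd t Y(1) by (intro skellam_pmf_power_series l) auto
  qed (use l t Y in auto)

  have equation: "caputo_differentiable \<alpha> (\<lambda>u. p n u t) s \<and>
      caputo_deriv \<alpha> (\<lambda>u. p n u t) s =
        - (l1 + l2) * t * p n s t + l1 * t * p (n - 1) s t + l2 * t * p (n + 1) s t"
    if s: "0 < s" and t: "0 \<le> t" for n s t
  proof -
    have AK: "\<bar>A n m * t ^ m\<bar> \<le> (2 * (l1 + l2) * t) ^ m" for m
      using A_bound[of n m] t by (simp add: abs_mult power_mult_distrib mult_right_mono)
    have f: "p n u t = (\<Sum>m. A n m * t ^ m / Gamma (\<alpha> * real m + 1) * (u powr \<alpha>) ^ m)" if "0 < u" for u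
      using p_series[of u t n] that t by (simp add: sums_iff power_mult_distrib mult_ac)
    have K: "0 \<le> 2 * (l1 + l2) * t" using l t by simp
    note caputo = caputo_powr_series[OF \<alpha> K AK s f]
    have "(\<lambda>m. t * (- (l1 + l2) * (A n m / Gamma (\<alpha> * real m + 1) * (s powr \<alpha> * t) ^ m) +
        l1 * (A (n - 1) m / Gamma (\<alpha> * real m + 1) * (s powr \<alpha> * t) ^ m) +
        l2 * (A (n + 1) m / Gamma (\<alpha> * real m + 1) * (s powr \<alpha> * t) ^ m))) sums
        (t * (- (l1 + l2) * p n s t + l1 * p (n - 1) s t + l2 * p (n + 1) s t))"
      using s t by (intro sums_mult sums_add p_series) auto
    also have "(\<lambda>m. t * (- (l1 + l2) * (A n m / Gamma (\<alpha> * real m + 1) * (s powr \<alpha> * t) ^ m) +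
        l1 * (A (n - 1) m / Gamma (\<alpha> * real m + 1) * (s powr \<alpha> * t) ^ m) +
        l2 * (A (n + 1) m / Gamma (\<alpha> * real m + 1) * (s powr \<alpha> * t) ^ m))) =
        (\<lambda>m. A n (Suc m) * t ^ Suc m / Gamma (\<alpha> * real m + 1) * (s powr \<alpha>) ^ m)"
    proof
      fix m
      have "t * (- (l1 + l2) * (a / g * (y * t) ^ m) + l1 * (b / g * (y * t) ^ m) + l2 * (c / g * (y * t) ^ m)) =
          (- (l1 + l2) * a + l1 * b + l2 * c) * t ^ Suc m / g * y ^ m" for a b c g y :: real
        by (simp add: power_mult_distrib divide_inverse algebra_simps)
      then show "t * (- (l1 + l2) * (A n m / Gamma (\<alpha> * real m + 1) * (s powr \<alpha> * t) ^ m) +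
        l1 * (A (n - 1) m / Gamma (\<alpha> * real m + 1) * (s powr \<alpha> * t) ^ m) +
        l2 * (A (n + 1) m / Gamma (\<alpha> * real m + 1) * (s powr \<alpha> * t) ^ m)) =
        A n (Suc m) * t ^ Suc m / Gamma (\<alpha> * real m + 1) * (s powr \<alpha>) ^ m"
        unfolding A_Suc .
    qed
    finally show ?thesis
      using caputo by (simp add: sums_iff algebra_simps)
  qed

  have "p 0 0 t = 1" if "0 \<le> t" for t
    using rep[of 0 t 0] that by (simp add: skellam_pmf_0_0 prob_space)
  with distribution equation show ?thesis by (simp add: Let_def)
qed

end
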